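(* Let $N\ge 2$, $w>0$, $X_0>0$, and assume that the asset price process $S$ satisfies (A1). For $t=1,\dots,N$ the withdrawal guarantee value $V_t$ is, on $\{\tau\ge t\}$, a function $V_t=V_t(S_t\,|\,\zeta_{t-1})$ of $S_t$ and $\zeta_{t-1}$. Suppose that for every $t=0,\dots,N-2$ the function $v(k):=V_{t+1}(k\,|\,\zeta_t)$ (with $\zeta_t>0$) satisfies the following smoothness and boundary conditions: $v$ and $v'$ are continuous at $k=w/\zeta_t$; at $k=0$ they take the values $v(0)=(N-t)w$ and $v'(0)=-\zeta_t$; and $v(k)\to 0$, $v'(k)=o(1/k)$ as $k\to\infty$. Then for $t=1,\dots,N-2$ the following backward recursion holds: (i) if $\tau<t$, then $V_t=(N-t+1)w$; (ii) if $\tau\ge t$ and $S_t\le w/\zeta_{t-1}$, then $V_t(S_t\,|\,\zeta_{t-1})=(N-t+1)w-\zeta_{t-1}S_t$; (iii) if $\tau\ge t$ and $S_t>w/\zeta_{t-1}$, then $$V_t(S_t\,|\,\zeta_{t-1})=\int_{\frac{w}{\zeta_{t-1}-w/S_t}}^\infty P_t(k\,|\,S_t)\cdot\left[\frac{\partial^2}{\partial S_{t+1}^2}V_{t+1}\Big(S_{t+1}\,\Big|\,\zeta_{t-1}-\frac{w}{S_t}\Big)\right]_{S_{t+1}=k}dk ,$$ with terminal condition, for $\tau\ge N-1$ and $S_{N-1}>w/\zeta_{N-2}$, $$V_{N-1}(S_{N-1}\,|\,\zeta_{N-2})=\Big(\zeta_{N-2}-\frac{w}{S_{N-1}}\Big)\cdot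 P_{N-1}\Big(\frac{w}{\zeta_{N-2}-\frac{w}{S_{N-1}}}\,\Big|\,S_{N-1}\Big).$$ The value of the withdrawal guarantee at time $T_0$ is then $$V_0=\int_{w/\zeta_0}^\infty P_0(k\,|\,S_0)\left[\frac{\partial^2}{\partial S_1^2}V_1(S_1\,|\,\zeta_0)\right]_{S_1=k}dk .$$
   Context: Withdrawal times are $0=T_0<T_1<\dots<T_N$ (equidistant). $(S_t)_{t=0,\dots,N}$ is the positive price process of an asset at times $T_t$, under the pricing (equivalent martingale) measure $\mathbb Q$ with filtration $(\mathcal F_t)$; $\mathbb E_t^{\mathbb Q}$ is conditional expectation given $\mathcal F_t$. Interest rates are zero, $S$ is a $\mathbb Q$-martingale, $S_0=1$. (A1): $S$ is a one-factor Markov process and every $S_t$ is continuously distributed. $P_t(K\,|\,s)=\mathbb E^{\mathbb Q}[(K-S_{t+1})^+\,|\,S_t=s]$ is the value at $T_t$ of a put on $S$ with strike $K$ and maturity $T_{t+1}$; as a consequence of the regularity in (A1), it is taken to be twice differentiable in $K$ and in $s$. Withdrawal fund: $X_{t+1}=X_t\cdot S_{t+1}/S_t-w$ for $t=0,\dots,N-1$ (initial value $X_0>0$, constant withdrawal $w>0$). $\zeta_t:=X_t/S_t$, so $\zeta_t=\zeta_{t-1}-w/S_t$. Depletion time: $\tau:=\inf\{t: X_t\le 0\}$. Guarantee claims: $Z^{(0)}=0$ and $Z^{(t)}=w\,\mathbf 1_{\tau\le t-1}+X_t^-\,\mathbf 1_{\tau=t}$ for $t=1,\dots,N$, where $x^-=-\min(0,x)$.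 Guarantee value: $V_t:=\mathbb E_t^{\mathbb Q}\big[\sum_{u=t}^N Z^{(u)}\big]$, $t=0,\dots,N$. The notation $v'(k)=o(1/k)$ means $k\,v'(k)\to0$. *)

theory Defs
  imports "HOL-Probability.Probability"
begin

definition twice_differentiable_on :: "(real \<Rightarrow> real) \<Rightarrow> real set \<Rightarrow> bool" where
  "twice_differentiable_on f A \<longleftrightarrow>
     (\<forall>x\<in>A. f differentiable (at x) \<and> deriv f differentiable (at x))"

subsection \<open>The asset price\<close>

locale price_process = prob_space M + filtration "space M" F
  for M :: "'a measure" and F :: "nat \<Rightarrow> 'a measure" +
  fixes S :: "nat \<Rightarrow> 'a \<Rightarrow> real" and N :: nat
  assumes subalgebra_F: "\<And>t. subalgebra M (F t)"
    and S_adapted: "\<And>t. t \<le> N \<Longrightarrow> S t \<in> borel_measurable (F t)"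
    and S_positive: "\<And>t. t \<le> N \<Longrightarrow> AE \<omega> in M. 0 < S t \<omega>"
    and S_start: "AE \<omega> in M. S 0 \<omega> = 1"
    and S_integrable: "\<And>t. t \<le> N \<Longrightarrow> integrable M (S t)"
    and S_martingale: "\<And>t. t < N \<Longrightarrow> AE \<omega> in M. real_cond_exp M (F t) (S (Suc t)) \<omega> = S t \<omega>"

text \<open>
  The measure \<open>\<kappa> t s\<close> is a regular version of the conditional law of \<open>S (Suc t)\<close> given \<open>S t = s\<close>;
  fixing it makes conditional expectations given \<open>S t = s\<close> meaningful for every single \<open>s > 0\<close>.
  The values \<open>\<kappa> t s\<close> for \<open>s \<le> 0\<close> play no role.
\<close>

definition put_price :: "(nat \<Rightarrow> real \<Rightarrow> real measure) \<Rightarrow> nat \<Rightarrow> real \<Rightarrow> real \<Rightarrow> real" where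
  "put_price \<kappa> t K s = (\<integral>y. max (K - y) 0 \<partial>\<kappa> t s)"

text \<open>The law of \<open>S 0 = 1\<close> is degenerate, so only \<open>S 1, \<dots>, S N\<close> can have a density.\<close>

locale markov_price_process = price_process M F S N
  for M :: "'a measure" and F :: "nat \<Rightarrow> 'a measure" and S :: "nat \<Rightarrow> 'a \<Rightarrow> real" and N :: nat +
  fixes \<kappa> :: "nat \<Rightarrow> real \<Rightarrow> real measure"
  assumes kernel: "\<And>t. t < N \<Longrightarrow> \<kappa> t \<in> measurable borel (prob_algebra borel)"
    and kernel_positive: "\<And>t s. t < N \<Longrightarrow> 0 < s \<Longrightarrow> AE y in \<kappa> t s. 0 < y"
    and markov: "\<And>t A. t < N \<Longrightarrow> A \<in> sets borel \<Longrightarrow>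
          AE \<omega> in M. real_cond_exp M (F t) (\<lambda>\<omega>. indicator A (S (Suc t) \<omega>)) \<omega>
                       = measure (\<kappa> t (S t \<omega>)) A"
    and S_density: "\<And>t. 1 \<le> t \<Longrightarrow> t \<le> N \<Longrightarrow> \<exists>f. distributed M lborel (S t) f"
    and put_smooth_strike: "\<And>t s. t < N \<Longrightarrow> 0 < s \<Longrightarrow>
          twice_differentiable_on (\<lambda>K. put_price \<kappa> t K s) {0<..}"
    and put_smooth_spot: "\<And>t K. t < N \<Longrightarrow> 0 < K \<Longrightarrow>
          twice_differentiable_on (\<lambda>s. put_price \<kappa> t K s) {0<..}"

subsection \<open>Withdrawal fund and guarantee claims\<close>

text \<open>Pathwise definitions: \<open>p u\<close> is the asset price at date \<open>u\<close>.\<close>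

primrec fund :: "real \<Rightarrow> real \<Rightarrow> (nat \<Rightarrow> real) \<Rightarrow> nat \<Rightarrow> real" where
  "fund w x0 p 0 = x0"
| "fund w x0 p (Suc t) = fund w x0 p t * p (Suc t) / p t - w"

definition depletion :: "nat \<Rightarrow> (nat \<Rightarrow> real) \<Rightarrow> enat" where
  "depletion N x = (INF t\<in>{t. t \<le> N \<and> x t \<le> 0}. enat t)"

primrec claim :: "real \<Rightarrow> nat \<Rightarrow> (nat \<Rightarrow> real) \<Rightarrow> nat \<Rightarrow> real" where
  "claim w N x 0 = 0"
| "claim w N x (Suc t) =
     w * of_bool (depletion N x \<le> enat t)
     + (- min 0 (x (Suc t))) * of_bool (depletion N x = enat (Suc t))"

subsection \<open>The guarantee value as a function of the state\<close>

text \<open>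
  \<open>markov_expect \<kappa> m t p g\<close> is the expectation of \<open>g\<close>, applied to the price path, given that the path
  up to date \<open>t\<close> is \<open>p\<close>, with the next \<open>m\<close> prices drawn successively from \<open>\<kappa>\<close>.
\<close>

primrec markov_expect ::
    "(nat \<Rightarrow> real \<Rightarrow> real measure) \<Rightarrow> nat \<Rightarrow> nat \<Rightarrow> (nat \<Rightarrow> real) \<Rightarrow> ((nat \<Rightarrow> real) \<Rightarrow> real) \<Rightarrow> real" where
  "markov_expect \<kappa> 0 t p g = g p"
| "markov_expect \<kappa> (Suc m) t p g =
     (\<integral>y. markov_expect \<kappa> m (Suc t) (p(Suc t := y)) g \<partial>\<kappa> t (p t))"

text \<open>
  The fund that holds \<open>z\<close> units of the asset before date \<open>t\<close> and pays its withdrawals at the dates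
  \<open>t, t + 1, \<dots>\<close>.  From date \<open>t\<close> on it is a fund in the state \<open>\<tau> \<ge> t\<close>, \<open>\<zeta> (t - 1) = z\<close>:
  for \<open>z > 0\<close> and positive prices it is not depleted before \<open>t\<close>.
\<close>

primrec fund_from :: "real \<Rightarrow> nat \<Rightarrow> real \<Rightarrow> (nat \<Rightarrow> real) \<Rightarrow> nat \<Rightarrow> real" where
  "fund_from w t z p 0 = z * p 0"
| "fund_from w t z p (Suc u) =
     fund_from w t z p u * p (Suc u) / p u - (if t \<le> Suc u then w else 0)"

text \<open>
  For \<open>1 \<le> t \<le> N\<close>, the expectation of the claims due at \<open>t, \<dots>, N\<close> given \<open>S t = s\<close>, \<open>\<zeta> (t - 1) = z\<close>
  and \<open>\<tau> \<ge> t\<close>.  The prices before \<open>t\<close> are irrelevant and are set to \<open>s\<close>.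
\<close>

definition value_fun ::
    "real \<Rightarrow> nat \<Rightarrow> (nat \<Rightarrow> real \<Rightarrow> real measure) \<Rightarrow> nat \<Rightarrow> real \<Rightarrow> real \<Rightarrow> real" where
  "value_fun w N \<kappa> t s z =
     markov_expect \<kappa> (N - t) t (\<lambda>_. s) (\<lambda>p. \<Sum>u=t..N. claim w N (fund_from w t z p) u)"

text \<open>
  Smoothness and boundary conditions on \<open>v = V\<^sub>t\<^sub>+\<^sub>1(\<cdot> | z)\<close>, where \<open>z = \<zeta>\<^sub>t\<close>.  Since prices are positive,
  the values of \<open>v\<close> and \<open>v'\<close> at \<open>0\<close> are the right limits there.
  Twice differentiability away from \<open>w / z\<close> is what gives a meaning to \<open>v''\<close> in the recursion.
\<close>

definition smooth_boundary :: "real \<Rightarrow> nat \<Rightarrow> nat \<Rightarrow> real \<Rightarrow> (real \<Rightarrow> real) \<Rightarrow> bool" where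
  "smooth_boundary w N t z v \<longleftrightarrow>
     twice_differentiable_on v ({0<..} - {w / z}) \<and>
     v differentiable (at (w / z)) \<and> isCont v (w / z) \<and> isCont (deriv v) (w / z) \<and>
     (v \<longlongrightarrow> real (N - t) * w) (at_right 0) \<and>
     (deriv v \<longlongrightarrow> - z) (at_right 0) \<and>
     (v \<longlongrightarrow> 0) at_top \<and>
     ((\<lambda>k. k * deriv v k) \<longlongrightarrow> 0) at_top"

end

(* Conditioning on the next price turns the value V_t above the depletion threshold into the
   integral of v = V_{t+1}(. | zeta_t) against the law mu of S_{t+1} given S_t.  At and below the
   threshold a = w / zeta_t all future claims are deterministic, so v is affine there with slope
   -zeta_t.  If P(k) is the put price with strike k, then P' is the distribution function of mu,
   and integrating P v'' by parts twice over [a, b] and letting b tend to infinity gives the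
   integral of v against mu: the boundary terms at infinity vanish by the growth conditions on v,
   and those at a make up the integral of the affine part over (0, a). *)
theory Submission
  imports Defs
begin

section \<open>Put prices and second derivatives\<close>

text \<open>A conditional expectation is fixed only up to null sets, whereas the value at the next
  date has to be differentiated at every price. The proof therefore has two layers.
  \<open>value_fun\<close> is built from the kernels \<open>\<kappa>\<close> alone, and its
  recursion is proved for every positive price and every positive number of units. Its almost sure
  agreement with the conditional expectation is a separate backward induction from \<open>N\<close>,
  resting on a disintegration of the joint law of the information at \<open>t\<close> and the next
  price. The pointwise step works because price and units held determine the further course of the
  fund: a withdrawal at price \<open>s\<close> turns \<open>z\<close> units into
  \<open>z - w / s\<close>, and a fund that is still positive can be restarted from there without
  changing any later claim. The kernels give positive prices only almost everywhere; hence the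
  comparisons of funds hold almost everywhere, and the value function is cut off outside positive
  arguments before it is conditioned.\<close>

context real_distribution
begin

text \<open>A convex function has only one subgradient at a point of differentiability, so it
  suffices to exhibit \<open>cdf M K\<close> as one. Differentiability at \<open>K\<close> is what
  excludes an atom there.\<close>

lemma put_has_derivative_cdf:
  assumes int: "\<And>K. integrable M (\<lambda>y. max (K - y) 0)"
    and diff: "(\<lambda>K. \<integral>y. max (K - y) 0 \<partial>M) differentiable (at K)"
  shows "((\<lambda>K. \<integral>y. max (K - y) 0 \<partial>M) has_real_derivative cdf M K) (at K)"
proof -
  let ?P = "\<lambda>K. \<integral>y. max (K - y) 0 \<partial>M"
  obtain D where D: "(?P has_real_derivative D) (at K)"
    using diff real_differentiable_def by blast
  \<comment> \<open>\<open>cdf M K\<close> is a subgradient of the convex function \<open>?P\<close> at \<open>K\<close>.\<close>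
  have sub: "?P K - K * cdf M K \<le> ?P L - L * cdf M K" for L
  proof -
    have "(\<integral>y. (L - K) * indicator {..K} y \<partial>M) \<le> (\<integral>y. max (L - y) 0 - max (K - y) 0 \<partial>M)"
      by (rule integral_mono) (auto intro!: Bochner_Integration.integrable_diff int
            integrable_real_indicator integrable_mult_right simp: emeasure_eq_measure split: split_indicator)
    also have "\<dots> = ?P L - ?P K"
      by (intro Bochner_Integration.integral_diff int)
    finally have "(\<integral>y. (L - K) * indicator {..K} y \<partial>M) \<le> ?P L - ?P K" .
    moreover have "(\<integral>y. (L - K) * indicator {..K} y \<partial>M) = (L - K) * cdf M K"
      by (simp add: cdf_def)
    ultimately show ?thesis
      by (simp add: left_diff_distrib)
  qed
  have "((\<lambda>L. ?P L - L * cdf M K) has_real_derivative D - cdf M K) (at K)"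
    using D by (auto intro!: derivative_eq_intros)
  \<comment> \<open>By \<open>sub\<close> the minimum at \<open>K\<close> is global, so any radius
    would do in place of 1.\<close>
  from DERIV_local_min[OF this, of 1] sub have "D = cdf M K"
    by auto
  with D show ?thesis by simp
qed

lemma cdf_measurable: "cdf M \<in> borel_measurable borel"
  by (rule borel_measurable_mono) (auto simp: mono_def cdf_nondecreasing)

text \<open>Integration by parts against a distribution function that may have no density: write
  \<open>cdf M k\<close> as the \<open>M\<close>-integral of \<open>indicator {..k} y\<close>,
  exchange the integrals, and integrate \<open>v'\<close> over \<open>k\<close>. Continuity of
  \<open>v'\<close> on the compact interval makes Fubini's theorem applicable.\<close>

lemma set_integral_deriv_times_cdf:
  fixes v v' :: "real \<Rightarrow> real"
  assumes "a \<le> b"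
    and deriv: "\<And>k. a \<le> k \<Longrightarrow> k \<le> b \<Longrightarrow> (v has_real_derivative v' k) (at k)"
    and cont: "continuous_on {a..b} v'"
  shows "set_integrable lborel {a..b} (\<lambda>k. v' k * cdf M k)" (is ?I)
    and "(LINT k:{a..b}|lborel. v' k * cdf M k)
           = v b * cdf M b - (\<integral>y. indicator {..b} y * v (max a y) \<partial>M)" (is ?E)
proof -
  interpret lborel_M: pair_sigma_finite lborel M ..
  define f where "f k y = indicator {a..b} k * v' k * indicator {..k} y" for k y :: real
  have int': "integrable lborel (\<lambda>k. indicator {a..b} k * v' k)"
    using borel_integrable_atLeastAtMost'[OF cont] by (simp add: set_integrable_def)
  have meas': "(\<lambda>k. indicator {a..b} k * v' k) \<in> borel_measurable borel"
    using borel_measurable_integrable[OF int'] by simp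
  have meas: "case_prod f \<in> borel_measurable (lborel \<Otimes>\<^sub>M M)"
  proof -
    note [measurable] = meas'
    \<comment> \<open>The set \<open>{..k}\<close> varies with \<open>k\<close>; as a function of
      the pair its indicator is that of the fixed set \<open>y \<le> k\<close>, whose measurability
      is immediate.\<close>
    have "(\<lambda>p. (indicator {a..b} (fst p) * v' (fst p)) * indicator {p. snd p \<le> fst p} p :: real)
            \<in> borel_measurable (borel \<Otimes>\<^sub>M borel)"
      by measurable
    moreover have "case_prod f
        = (\<lambda>p. (indicator {a..b} (fst p) * v' (fst p)) * indicator {p. snd p \<le> fst p} p)"
      by (auto simp: f_def indicator_def fun_eq_iff)
    moreover have "sets (lborel \<Otimes>\<^sub>M M) = sets (borel \<Otimes>\<^sub>M borel)"
      by (intro sets_pair_measure_cong) auto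
    ultimately show ?thesis
      by (simp cong: measurable_cong_sets)
  qed
  have cdf: "(\<integral>y. f k y \<partial>M) = indicator {a..b} k * (v' k * cdf M k)" for k
    by (simp add: f_def cdf_def)
  have "integrable (lborel \<Otimes>\<^sub>M M) (case_prod f)"
  proof (rule lborel_M.Fubini_integrable[OF meas])
    have "(\<integral>y. norm (case (k, y) of (k, y) \<Rightarrow> f k y) \<partial>M) = norm (indicator {a..b} k * v' k) * cdf M k" for k
      by (simp add: f_def cdf_def abs_mult)
    moreover have "integrable lborel (\<lambda>k. norm (indicator {a..b} k * v' k) * cdf M k)"
      using int'
    proof (rule Bochner_Integration.integrable_bound)
      show "(\<lambda>k. norm (indicator {a..b} k * v' k) * cdf M k) \<in> borel_measurable lborel"
        using meas' cdf_measurable by (intro borel_measurable_times borel_measurable_norm) auto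
    qed (auto intro!: mult_left_le simp: abs_mult cdf_bounded_prob cdf_nonneg)
    ultimately show "integrable lborel (\<lambda>k. \<integral>y. norm (case (k, y) of (k, y) \<Rightarrow> f k y) \<partial>M)"
      by simp
    show "AE k in lborel. integrable M (\<lambda>y. case (k, y) of (k, y) \<Rightarrow> f k y)"
      by (auto simp: f_def intro!: integrable_mult_right integrable_real_indicator simp: emeasure_eq_measure)
  qed
  note f = this
  show ?I
    using lborel_M.integrable_fst[OF f] by (simp add: cdf set_integrable_def)
  \<comment> \<open>The constraints \<open>a \<le> k\<close> and \<open>y \<le> k\<close> combine to
    the lower limit \<open>max a y\<close>, where the fundamental theorem evaluates
    \<open>v\<close>.\<close>
  have inner: "(\<integral>k. f k y \<partial>lborel) = indicator {..b} y * v b - indicator {..b} y * v (max a y)" for y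
  proof (cases "y \<le> b")
    case True
    have "(\<integral>k. indicator {max a y..b} k *\<^sub>R v' k \<partial>lborel) = v b - v (max a y)"
    proof (rule integral_FTC_Icc)
      show "(v has_vector_derivative v' k) (at k within {max a y..b})"
        if "max a y \<le> k" "k \<le> b" for k
        using deriv[of k] that
        by (simp add: has_real_derivative_iff_has_vector_derivative has_vector_derivative_at_within)
      show "continuous_on {max a y..b} v'"
        using cont by (rule continuous_on_subset) auto
    qed (use True \<open>a \<le> b\<close> in auto)
    moreover have "f k y = indicator {max a y..b} k *\<^sub>R v' k" for k
      by (auto simp: f_def indicator_def)
    ultimately show ?thesis using True by simp
  next
    case False
    then have "f k y = 0" for k by (auto simp: f_def indicator_def)
    with False show ?thesis by simp
  qed
  have contv: "continuous_on {a..b} v"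
    by (intro continuous_at_imp_continuous_on ballI DERIV_isCont[OF deriv]) auto
  have contw: "continuous_on {..b} (\<lambda>y. v (max a y))"
    by (rule continuous_on_compose2[OF contv]) (use \<open>a \<le> b\<close> in \<open>auto intro!: continuous_intros\<close>)
  then have measw: "(\<lambda>y. indicator {..b} y * v (max a y)) \<in> borel_measurable borel"
    using borel_measurable_continuous_on_indicator[OF _ contw] by simp
  obtain C where C: "\<And>y. y \<in> {a..b} \<Longrightarrow> norm (v y) \<le> C"
    using compact_imp_bounded[OF compact_continuous_image[OF contv compact_Icc]]
    unfolding bounded_iff by blast
  have "norm (indicator {..b} y * v (max a y)) \<le> \<bar>C\<bar>" for y
    using C[of "max a y"] \<open>a \<le> b\<close> by (auto split: split_indicator)
  then have "integrable M (\<lambda>y. indicator {..b} y * v (max a y))"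
    by (intro integrable_const_bound[where B = "\<bar>C\<bar>"] AE_I2 measurable_finite_borel measw)
  moreover have "integrable M (\<lambda>y. indicator {..b} y * v b)"
    by (intro integrable_mult_left integrable_real_indicator) (auto simp: emeasure_eq_measure)
  ultimately have "(\<integral>y. \<integral>k. f k y \<partial>lborel \<partial>M)
      = v b * cdf M b - (\<integral>y. indicator {..b} y * v (max a y) \<partial>M)"
    by (simp add: inner cdf_def)
  moreover have "(\<integral>y. \<integral>k. f k y \<partial>lborel \<partial>M) = (\<integral>k. indicator {a..b} k * (v' k * cdf M k) \<partial>lborel)"
    using lborel_M.Fubini_integral[OF f] by (simp add: cdf)
  ultimately show ?E
    by (simp add: set_lebesgue_integral_def)
qed

lemma integrable_put:
  assumes "AE y in M. 0 < y"
  shows "integrable M (\<lambda>y. max (K - y) 0)"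
  by (rule integrable_const_bound[where B = "\<bar>K\<bar>"]) (use assms in \<open>auto elim!: eventually_mono\<close>)

text \<open>
  No sign or integrability is known for \<open>v''\<close>, so Fubini's theorem does not apply to \<open>P k * v'' k\<close>.
  Integration by parts for the gauge integral leaves \<open>cdf M k * v' k\<close>, where \<open>v'\<close> is continuous,
  and Fubini's theorem applies to that.
\<close>

lemma put_times_second_deriv_has_integral:
  fixes v v' v'' :: "real \<Rightarrow> real" and a c :: real
  defines "P \<equiv> \<lambda>K. \<integral>y. max (K - y) 0 \<partial>M"
  assumes pos: "AE y in M. 0 < y"
    and P: "\<And>K. 0 < K \<Longrightarrow> P differentiable (at K)"
    and "0 < a"
    and meas: "v \<in> borel_measurable borel"
    and linear: "\<And>k. 0 < k \<Longrightarrow> k \<le> a \<Longrightarrow> v k = v a + c * (a - k)"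
    and v: "\<And>k. a \<le> k \<Longrightarrow> (v has_real_derivative v' k) (at k)"
    and v': "\<And>k. a < k \<Longrightarrow> (v' has_real_derivative v'' k) (at k)"
    and v'_a: "isCont v' a" "v' a = - c"
    and lim: "(v \<longlongrightarrow> 0) at_top" "((\<lambda>k. k * v' k) \<longlongrightarrow> 0) at_top"
  shows "((\<lambda>k. P k * v'' k) has_integral (\<integral>y. v y \<partial>M)) {a..}"
proof -
  have P': "(P has_real_derivative cdf M K) (at K)" if "0 < K" for K
    using put_has_derivative_cdf[OF integrable_put[OF pos]] P[OF that] by (simp add: P_def)
  have contv': "isCont v' k" if "a \<le> k" for k
    using v'[of k] v'_a(1) that by (cases "k = a") (auto intro: DERIV_isCont)
  \<comment> \<open>\<open>I b\<close> is the outcome of two integrations by parts on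
    \<open>{a..b}\<close>: the boundary terms of the first, minus the integral of
    \<open>v' k * cdf M k\<close>, whose non-boundary part is \<open>J b\<close>.\<close>
  define J where "J b = (\<integral>y. indicator {..b} y * v (max a y) \<partial>M)" for b
  define I where "I b = P b * v' b - P a * v' a - (v b * cdf M b - J b)" for b
  have I: "((\<lambda>k. P k * v'' k) has_integral I b) {a..b}" if "a \<le> b" for b
  proof -
    have cont': "continuous_on {a..b} v'"
      using contv' by (auto intro!: continuous_at_imp_continuous_on)
    have 1: "((\<lambda>k. P k * v'' k + v' k * cdf M k) has_integral P b * v' b - P a * v' a) {a..b}"
    \<comment> \<open>At the threshold \<open>a\<close> only continuity of \<open>v'\<close> is
      available, so the product rule is used in the open interval and continuity at its
      ends.\<close>
    proof (rule fundamental_theorem_of_calculus_interior[OF that])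
      have "continuous_on {a..b} P"
        using \<open>0 < a\<close>
        by (intro continuous_at_imp_continuous_on ballI DERIV_isCont[OF P']) auto
      then show "continuous_on {a..b} (\<lambda>k. P k * v' k)"
        by (intro continuous_intros cont')
      show "((\<lambda>k. P k * v' k) has_vector_derivative P k * v'' k + v' k * cdf M k) (at k)"
        if "k \<in> {a<..<b}" for k
        using that \<open>0 < a\<close> P'[of k] v'[of k]
        by (auto intro!: derivative_eq_intros simp flip: has_real_derivative_iff_has_vector_derivative)
    qed
    have 2: "((\<lambda>k. v' k * cdf M k) has_integral (v b * cdf M b - J b)) {a..b}"
    proof -
      note * = set_integral_deriv_times_cdf[OF that v cont']
      show ?thesis
        using set_borel_integral_eq_integral[OF *(1)] *(2)
        by (simp add: J_def has_integral_iff)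
    qed
    show ?thesis
      using has_integral_diff[OF 1 2] by (simp add: I_def)
  qed
  have "continuous_on {a..} v"
    by (intro continuous_at_imp_continuous_on ballI DERIV_isCont[OF v]) auto
  then have "continuous_on UNIV (\<lambda>y. v (max a y))"
    by (rule continuous_on_compose2) (auto intro!: continuous_intros)
  then have measw: "(\<lambda>y. v (max a y)) \<in> borel_measurable borel"
    by (rule borel_measurable_continuous_onI)
  \<comment> \<open>Bounded by compactness up to some \<open>b\<close>, and by 1 beyond it because
    \<open>v\<close> tends to 0. The bound serves as the dominating function for the limit of
    \<open>J\<close>.\<close>
  obtain C where C: "\<And>y. \<bar>v (max a y)\<bar> \<le> C"
  proof -
    obtain b where b: "\<And>k. b \<le> k \<Longrightarrow> \<bar>v k\<bar> < 1"
      using lim(1)[THEN tendstoD, of 1] by (auto simp: eventually_at_top_linorder)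
    have "continuous_on {a..b} v"
      using \<open>continuous_on {a..} v\<close> by (rule continuous_on_subset) auto
    from compact_imp_bounded[OF compact_continuous_image[OF this compact_Icc]]
    obtain C where "\<And>k. k \<in> {a..b} \<Longrightarrow> norm (v k) \<le> C"
      unfolding bounded_iff by blast
    then have "\<bar>v k\<bar> \<le> max 1 C" if "a \<le> k" for k
      using b[of k] that by (cases "b \<le> k") (force simp: le_max_iff_disj)+
    then have "\<bar>v (max a y)\<bar> \<le> max 1 C" for y
      by simp
    then show ?thesis by (rule that)
  qed
  have intw: "integrable M (\<lambda>y. v (max a y))"
    by (rule integrable_const_bound[where B = C]) (use measw C in auto)
  have J: "(J \<longlongrightarrow> (\<integral>y. v (max a y) \<partial>M)) at_top"
    unfolding J_def
  proof (rule tendsto_at_topI_sequentially)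
    fix X :: "nat \<Rightarrow> real" assume X: "filterlim X at_top sequentially"
    show "(\<lambda>n. \<integral>y. indicator {..X n} y * v (max a y) \<partial>M) \<longlonglongrightarrow> (\<integral>y. v (max a y) \<partial>M)"
    proof (rule integral_dominated_convergence[where w = "\<lambda>_. C"])
      show "AE y in M. (\<lambda>n. indicator {..X n} y * v (max a y)) \<longlonglongrightarrow> v (max a y)"
      proof (rule AE_I2)
        fix y
        have "eventually (\<lambda>n. y \<le> X n) sequentially"
          using X by (auto simp: filterlim_at_top)
        then show "(\<lambda>n. indicator {..X n} y * v (max a y)) \<longlonglongrightarrow> v (max a y)"
          by (rule tendsto_eventually[OF eventually_mono]) auto
      qed
    qed (use measw C order_trans[OF abs_ge_zero C] in \<open>auto split: split_indicator\<close>)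
  qed
  \<comment> \<open>A put on a positive asset is worth at most its strike, so this boundary term is
    dominated by \<open>b * v' b\<close>.\<close>
  have "((\<lambda>b. P b * v' b) \<longlongrightarrow> 0) at_top"
  proof (rule Lim_null_comparison[OF _ lim(2)[THEN tendsto_rabs_zero]])
    have "norm (P b * v' b) \<le> \<bar>b * v' b\<bar>" if "0 \<le> b" for b
    proof -
      have "P b \<le> (\<integral>y. b \<partial>M)"
        unfolding P_def
        by (rule integral_mono_AE)
          (use pos that integrable_put[OF pos] in \<open>auto elim!: eventually_mono\<close>)
      moreover have "0 \<le> P b"
        unfolding P_def by (rule Bochner_Integration.integral_nonneg) simp
      ultimately show ?thesis
        using that prob_space by (simp add: abs_mult mult_right_mono)
    qed
    then show "\<forall>\<^sub>F b in at_top. norm (P b * v' b) \<le> \<bar>b * v' b\<bar>"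
      by (rule eventually_mono[OF eventually_ge_at_top[of 0]])
  qed
  then have "(I \<longlongrightarrow> 0 - P a * v' a - (0 * 1 - (\<integral>y. v (max a y) \<partial>M))) at_top"
    unfolding I_def by (intro tendsto_intros lim J cdf_lim_at_top_prob)
  also have "0 - P a * v' a - (0 * 1 - (\<integral>y. v (max a y) \<partial>M)) = (\<integral>y. c * max (a - y) 0 + v (max a y) \<partial>M)"
    using intw integrable_put[OF pos] by (simp add: P_def v'_a(2))
  also have "\<dots> = (\<integral>y. v y \<partial>M)"
  \<comment> \<open>Since \<open>v' a = - c\<close>, the boundary term at \<open>a\<close> is
    \<open>c * P a\<close>, the integral of \<open>c * max (a - y) 0\<close>. This is the excess of
    \<open>v y\<close> over \<open>v a\<close> on the affine part, so it undoes the clamping in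
    \<open>v (max a y)\<close>.\<close>
  proof (rule integral_cong_AE)
    show "AE y in M. c * max (a - y) 0 + v (max a y) = v y"
      using pos
    proof eventually_elim
      case (elim y)
      then show ?case
        using linear[of y] by (cases "y \<le> a") (auto simp: max_def)
    qed
  qed (use measw meas in auto)
  finally have lim_I: "(I \<longlongrightarrow> (\<integral>y. v y \<partial>M)) at_top" .
  show ?thesis
    \<comment> \<open>The improper integral is reduced to integrability on boxes and convergence
      over growing boxes. A box around a large ball meets \<open>{a..}\<close> in some
      \<open>{a..u}\<close>, where the integral is \<open>I u\<close>.\<close>
    unfolding has_integral_alt'
  proof (intro conjI allI impI)
    fix l u :: real
    \<comment> \<open>\<open>I\<close> describes the integral only for upper limits at least
      \<open>a\<close>; \<open>max a u\<close> also covers boxes that end before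
      \<open>a\<close>.\<close>
    have "(\<lambda>k. P k * v'' k) integrable_on {a..max a u}"
      using I[of "max a u"] by auto
    then have "(\<lambda>k. P k * v'' k) integrable_on {max a l..u}"
      by (rule integrable_on_subinterval) auto
    also have "{max a l..u} = {a..} \<inter> cbox l u"
      by auto
    finally show "(\<lambda>k. if k \<in> {a..} then P k * v'' k else 0) integrable_on cbox l u"
      by (simp only: integrable_restrict_Int)
  next
    fix e :: real assume "0 < e"
    then obtain B0 where B0: "\<And>b. B0 \<le> b \<Longrightarrow> \<bar>I b - (\<integral>y. v y \<partial>M)\<bar> < e"
      using lim_I[THEN tendstoD, of e] by (auto simp: eventually_at_top_linorder dist_real_def)
    define B where "B = max a B0"
    show "\<exists>B>0. \<forall>l u. ball 0 B \<subseteq> cbox l u \<longrightarrow>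
        norm (integral (cbox l u) (\<lambda>k. if k \<in> {a..} then P k * v'' k else 0) - (\<integral>y. v y \<partial>M)) < e"
    \<comment> \<open>The ball is open: radius \<open>B + 1\<close> places \<open>B\<close> itself
      inside the box, which gives \<open>B \<le> u\<close>.\<close>
    proof (intro exI[of _ "B + 1"] conjI allI impI)
      show "0 < B + 1" using \<open>0 < a\<close> by (simp add: B_def)
      fix l u :: real assume "ball 0 (B + 1) \<subseteq> cbox l u"
      moreover have "B \<in> ball 0 (B + 1)" "0 \<in> ball 0 (B + 1)"
        using \<open>0 < a\<close> by (auto simp: B_def)
      ultimately have "B \<in> cbox l u" "0 \<in> cbox l u" by blast+
      then have "B \<le> u" "l \<le> 0" by auto
      with \<open>0 < a\<close> have "{a..} \<inter> cbox l u = {a..u}" "a \<le> u" "B0 \<le> u"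
        by (auto simp: B_def)
      then show "norm (integral (cbox l u) (\<lambda>k. if k \<in> {a..} then P k * v'' k else 0) - (\<integral>y. v y \<partial>M)) < e"
        using B0[of u] integral_unique[OF I[of u]] by (simp only: integral_restrict_Int real_norm_def)
    qed
  qed
qed

end

section \<open>Claims along a path\<close>

lemma depletion_ge_iff: "enat t \<le> depletion N x \<longleftrightarrow> (\<forall>u<t. u \<le> N \<longrightarrow> 0 < x u)"
  unfolding depletion_def le_INF_iff by (auto simp: not_le) (metis leI not_less)

lemma depletion_le_iff: "depletion N x \<le> enat t \<longleftrightarrow> (\<exists>u\<le>t. u \<le> N \<and> x u \<le> 0)"
  using depletion_ge_iff[of "Suc t" N x] by (auto simp: Suc_ile_eq not_le not_less less_Suc_eq_le)

lemma depletion_eq_iff: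
  "depletion N x = enat t \<longleftrightarrow> t \<le> N \<and> x t \<le> 0 \<and> (\<forall>u<t. 0 < x u)"
proof -
  have "depletion N x = enat t \<longleftrightarrow> depletion N x \<le> enat t \<and> enat t \<le> depletion N x"
    by auto
  also have "\<dots> \<longleftrightarrow> t \<le> N \<and> x t \<le> 0 \<and> (\<forall>u<t. 0 < x u)"
    unfolding depletion_le_iff depletion_ge_iff
    by (metis linorder_not_less nat_less_le order.trans nless_le)
  finally show ?thesis .
qed

text \<open>Replaces the infimum in \<open>depletion\<close> by sign conditions at finitely many
  dates. Congruence, bounds and measurability of claims are read off from this form, so the defining
  equation leaves the simpset.\<close>

lemma claim_Suc:
  "claim w N x (Suc t) =
     w * of_bool (\<exists>u\<le>t. u \<le> N \<and> x u \<le> 0)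
     + - min 0 (x (Suc t)) * of_bool (Suc t \<le> N \<and> x (Suc t) \<le> 0 \<and> (\<forall>u\<le>t. 0 < x u))"
  by (simp add: depletion_le_iff depletion_eq_iff less_Suc_eq_le)

declare claim.simps(2) [simp del]

lemma claim_depleted:
  assumes "u < t" "t \<le> N" "x u \<le> 0"
  shows "claim w N x t = w"
proof -
  from assms obtain t' where "t = Suc t'" "u \<le> t'"
    by (cases t) auto
  with assms show ?thesis
    by (force simp: claim_Suc)
qed

lemma claim_alive:
  assumes "\<And>u. u \<le> t \<Longrightarrow> 0 < x u"
  shows "claim w N x t = 0"
proof (cases t)
  case (Suc t')
  with assms have "\<not> x u \<le> 0" if "u \<le> Suc t'" for u
    using that by (simp add: not_le)
  with Suc show ?thesis by (auto simp: claim_Suc)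
qed simp

lemma claim_at_depletion:
  assumes "\<And>u. u < t \<Longrightarrow> 0 < x u" "0 < t" "t \<le> N" "x t \<le> 0"
  shows "claim w N x t = - x t"
proof -
  from assms(2) obtain t' where t': "t = Suc t'"
    by (cases t) auto
  then have "0 < x u" if "u \<le> t'" for u
    using that assms(1) by simp
  moreover from this have "\<not> (\<exists>u\<le>t'. u \<le> N \<and> x u \<le> 0)"
    by force
  ultimately show ?thesis
    using assms(3,4) t' by (simp add: claim_Suc)
qed

lemma sum_claims_depleted:
  assumes "u < t" "t \<le> Suc N" "x u \<le> 0"
  shows "(\<Sum>i=t..N. claim w N x i) = real (Suc N - t) * w"
proof -
  have "(\<Sum>i=t..N. claim w N x i) = (\<Sum>i=t..N. w)"
    using assms by (intro sum.cong) (auto intro: claim_depleted[of u])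
  then show ?thesis by simp
qed

lemma sum_claims_at_depletion:
  assumes "\<And>u. u < t \<Longrightarrow> 0 < x u" "0 < t" "t \<le> N" "x t \<le> 0"
  shows "(\<Sum>i=t..N. claim w N x i) = real (N - t) * w - x t"
  using assms sum_claims_depleted[of t "Suc t" N x w] claim_at_depletion[of t x N w]
  by (simp add: sum.atLeast_Suc_atMost)

lemma sum_claims_alive:
  assumes "\<And>u. u \<le> t \<Longrightarrow> 0 < x u" "t \<le> N"
  shows "(\<Sum>i=t..N. claim w N x i) = (\<Sum>i=Suc t..N. claim w N x i)"
  using assms by (simp add: sum.atLeast_Suc_atMost claim_alive)

text \<open>Before \<open>t\<close> the two paths may differ as long as both are positive, since a
  claim sees earlier dates only through their signs. This is what allows a fund to be exchanged for
  a restarted one.\<close>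

lemma claim_cong:
  assumes "\<And>u. u < t \<Longrightarrow> 0 < x u" "\<And>u. u < t \<Longrightarrow> 0 < y u"
    and "\<And>u. t \<le> u \<Longrightarrow> u \<le> i \<Longrightarrow> x u = y u" "t \<le> i"
  shows "claim w N x i = claim w N y i"
proof (cases i)
  case (Suc j)
  have "x u \<le> 0 \<longleftrightarrow> y u \<le> 0" if "u \<le> j" for u
    using assms(1-3)[of u] that Suc by (cases "u < t") (auto simp: not_less)
  then have "(\<exists>u\<le>j. u \<le> N \<and> x u \<le> 0) = (\<exists>u\<le>j. u \<le> N \<and> y u \<le> 0)"
    "(\<forall>u\<le>j. 0 < x u) = (\<forall>u\<le>j. 0 < y u)"
    by (auto simp flip: not_le)
  moreover have "x (Suc j) = y (Suc j)"
    using assms(3,4) Suc by simp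
  ultimately show ?thesis
    unfolding Suc claim_Suc by simp
qed simp

text \<open>The hypothesis \<open>lower\<close> says that one date can take a positive fund at most
  \<open>w\<close> below zero, as is the case for positive prices. Hence the shortfall paid at
  depletion is at most \<open>w\<close>, like every later claim.\<close>

lemma sum_claims_bounds:
  assumes "0 \<le> w" and lower: "\<And>u. u < N \<Longrightarrow> 0 < x u \<Longrightarrow> - w \<le> x (Suc u)"
  shows "0 \<le> (\<Sum>i=t..N. claim w N x i)" "(\<Sum>i=t..N. claim w N x i) \<le> real (Suc N - t) * w"
proof -
  have "0 \<le> claim w N x i \<and> claim w N x i \<le> w" for i
  proof (cases i)
    case (Suc j)
    show ?thesis
    proof (cases "\<exists>u\<le>j. u \<le> N \<and> x u \<le> 0")
      case True
      then have "(\<exists>u\<le>j. u \<le> N \<and> x u \<le> 0) = True" "(\<forall>u\<le>j. 0 < x u) = False"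
        by (blast, force)
      with Suc \<open>0 \<le> w\<close> show ?thesis
        unfolding Suc claim_Suc by auto
    next
      case False
      then show ?thesis
        using Suc \<open>0 \<le> w\<close> lower[of j] by (auto simp: claim_Suc min_def)
    qed
  qed (use \<open>0 \<le> w\<close> in simp)
  then show "0 \<le> (\<Sum>i=t..N. claim w N x i)" "(\<Sum>i=t..N. claim w N x i) \<le> real (Suc N - t) * w"
    using sum_bounded_above[of "{t..N}" "claim w N x" w] by (auto intro: sum_nonneg)
qed

section \<open>Restarted funds and iterated kernel expectations\<close>

lemma fund_from_before:
  assumes "u < t" "\<And>i. i \<le> u \<Longrightarrow> p i = s" "s \<noteq> 0"
  shows "fund_from w t z p u = z * s"
  using assms by (induction u) auto

lemma fund_from_at:
  assumes "0 < t" "\<And>i. i \<le> t \<Longrightarrow> p i = s" "s \<noteq> 0"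
  shows "fund_from w t z p t = z * s - w"
proof -
  from \<open>0 < t\<close> obtain t' where t': "t = Suc t'" by (cases t) auto
  then have "fund_from w t z p t' = z * s" using assms by (intro fund_from_before) auto
  with t' assms show ?thesis by simp
qed

text \<open>Both funds have begun their withdrawals by \<open>t\<close>, so afterwards they obey the
  same recursion and agreement at \<open>t\<close> propagates.\<close>

lemma fund_from_cong:
  assumes "t \<le> u" "T \<le> t" "T' \<le> t" "\<And>i. t \<le> i \<Longrightarrow> i \<le> u \<Longrightarrow> p i = q i"
    and "fund_from w T z p t = fund_from w T' z' q t"
  shows "fund_from w T z p u = fund_from w T' z' q u"
  using assms(1,4)
proof (induction u rule: dec_induct)
  case base
  show ?case by fact
next
  case (step u)
  then have "p u = q u" "p (Suc u) = q (Suc u)" "fund_from w T z p u = fund_from w T' z' q u"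
    by auto
  with step.hyps assms(2,3) show ?case by simp
qed



text \<open>The kernel reads only the current price, so the histories need to agree only at
  \<open>t\<close>. The payoffs may differ as well; they are compared on continuations of the two
  histories by the same future prices.\<close>

lemma markov_expect_cong:
  assumes "p t = q t"
    and "\<And>p' q'. (\<And>u. u \<le> t \<Longrightarrow> p' u = p u) \<Longrightarrow> (\<And>u. u \<le> t \<Longrightarrow> q' u = q u)
           \<Longrightarrow> (\<And>u. t \<le> u \<Longrightarrow> u \<le> t + m \<Longrightarrow> p' u = q' u) \<Longrightarrow> g p' = h q'"
  shows "markov_expect \<kappa> m t p g = markov_expect \<kappa> m t q h"
  using assms
proof (induction m arbitrary: t p q)
  case 0
  then show ?case by simp
next
  case (Suc m)
  have "markov_expect \<kappa> m (Suc t) (p(Suc t := y)) g = markov_expect \<kappa> m (Suc t) (q(Suc t := y)) h" for y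
  proof (rule Suc.IH)
    fix p' q'
    assume *: "\<And>u. u \<le> Suc t \<Longrightarrow> p' u = (p(Suc t := y)) u" "\<And>u. u \<le> Suc t \<Longrightarrow> q' u = (q(Suc t := y)) u"
      "\<And>u. Suc t \<le> u \<Longrightarrow> u \<le> Suc t + m \<Longrightarrow> p' u = q' u"
    show "g p' = h q'"
    proof (rule Suc.prems(2))
      show "p' u = q' u" if "t \<le> u" "u \<le> t + Suc m" for u
        using that *(1)[of u] *(2)[of u] *(3)[of u] Suc.prems(1) by (cases "u = t") auto
    qed (use *(1,2) in auto)
  qed simp
  with Suc.prems(1) show ?case by simp
qed

lemma markov_expect_const:
  assumes "\<And>u s. t \<le> u \<Longrightarrow> u < t + m \<Longrightarrow> prob_space (\<kappa> u s)"
    and "\<And>p'. (\<And>u. u \<le> t \<Longrightarrow> p' u = p u) \<Longrightarrow> g p' = c"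
  shows "markov_expect \<kappa> m t p g = c"
  using assms
proof (induction m arbitrary: t p)
  case 0
  then show ?case by simp
next
  case (Suc m)
  have "markov_expect \<kappa> m (Suc t) (p(Suc t := y)) g = c" for y
    using Suc.prems by (intro Suc.IH) auto
  moreover have "prob_space (\<kappa> t (p t))"
    using Suc.prems(1) by simp
  ultimately show ?case
    by (simp add: prob_space.prob_space)
qed

section \<open>The recursion for the guarantee value\<close>

lemma fund_measurable:
  assumes "\<And>i. i \<le> t \<Longrightarrow> (\<lambda>\<omega>. p \<omega> i) \<in> borel_measurable M"
  shows "(\<lambda>\<omega>. fund w x0 (p \<omega>) t) \<in> borel_measurable M"
  using assms
proof (induction t)
  case (Suc t)
  then have [measurable]: "(\<lambda>\<omega>. fund w x0 (p \<omega>) t) \<in> borel_measurable M"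
    "(\<lambda>\<omega>. p \<omega> t) \<in> borel_measurable M" "(\<lambda>\<omega>. p \<omega> (Suc t)) \<in> borel_measurable M"
    by auto
  show ?case by simp
qed simp

lemma fund_from_measurable:
  assumes [measurable]: "z \<in> borel_measurable M"
    and "\<And>i. (\<lambda>\<omega>. p \<omega> i) \<in> borel_measurable M"
  shows "(\<lambda>\<omega>. fund_from w t (z \<omega>) (p \<omega>) u) \<in> borel_measurable M"
proof (induction u)
  case 0
  have [measurable]: "(\<lambda>\<omega>. p \<omega> 0) \<in> borel_measurable M" by fact
  show ?case by simp
next
  case (Suc u)
  note [measurable] = Suc assms(2)[of u] assms(2)[of "Suc u"]
  show ?case by simp
qed

lemma claim_measurable:
  assumes x: "\<And>u. u \<le> t \<Longrightarrow> (\<lambda>\<omega>. x \<omega> u) \<in> borel_measurable M"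
  shows "(\<lambda>\<omega>. claim w N (x \<omega>) t) \<in> borel_measurable M"
proof (cases t)
  case (Suc t')
  have x' [measurable]: "(\<lambda>\<omega>. x \<omega> (Suc t')) \<in> borel_measurable M"
    using x Suc by simp
  have le: "Measurable.pred M (\<lambda>\<omega>. u \<le> N \<and> x \<omega> u \<le> 0)"
    and gr: "Measurable.pred M (\<lambda>\<omega>. 0 < x \<omega> u)" if "u \<in> {..t'}" for u
  proof -
    have [measurable]: "(\<lambda>\<omega>. x \<omega> u) \<in> borel_measurable M"
      using x Suc that by simp
    show "Measurable.pred M (\<lambda>\<omega>. u \<le> N \<and> x \<omega> u \<le> 0)" "Measurable.pred M (\<lambda>\<omega>. 0 < x \<omega> u)"
      by measurable
  qed
  define dead alive where "dead \<omega> \<longleftrightarrow> (\<exists>u\<in>{..t'}. u \<le> N \<and> x \<omega> u \<le> 0)"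
    and "alive \<omega> \<longleftrightarrow> (\<forall>u\<in>{..t'}. 0 < x \<omega> u)" for \<omega>
  have [measurable]: "Measurable.pred M dead"
    unfolding dead_def by (rule pred_intros_finite(4)[OF finite_atMost le])
  have [measurable]: "Measurable.pred M alive"
    unfolding alive_def by (rule pred_intros_finite(3)[OF finite_atMost gr])
  have "(\<lambda>\<omega>. claim w N (x \<omega>) (Suc t')) =
     (\<lambda>\<omega>. w * of_bool (dead \<omega>)
     + - min 0 (x \<omega> (Suc t')) * of_bool (Suc t' \<le> N \<and> x \<omega> (Suc t') \<le> 0 \<and> alive \<omega>))"
    unfolding claim_Suc dead_def alive_def by (simp only: Bex_def Ball_def atMost_iff)
  also have "\<dots> \<in> borel_measurable M"
    by measurable
  finally show ?thesis using Suc by simp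
qed simp

text \<open>The integral of \<open>f x\<close> against \<open>K x\<close> is that of the uncurried
  function against the image of \<open>K x\<close> under \<open>Pair x\<close>, and these images
  form a measurable kernel on the product.\<close>

lemma integral_kernel_measurable:
  fixes f :: "'b \<Rightarrow> 'c \<Rightarrow> real"
  assumes [measurable]: "(\<lambda>(x, y). f x y) \<in> borel_measurable (A \<Otimes>\<^sub>M B)"
    and [measurable]: "K \<in> measurable A (subprob_algebra B)"
  shows "(\<lambda>x. \<integral>y. f x y \<partial>K x) \<in> borel_measurable A"
proof -
  note [measurable] = measurable_distr2
  have "(\<lambda>x. \<integral>q. (\<lambda>(x, y). f x y) q \<partial>distr (K x) (A \<Otimes>\<^sub>M B) (Pair x)) \<in> borel_measurable A"
    by measurable
  then show ?thesis
    by (rule measurable_cong[THEN iffD1, rotated]) (simp add: integral_distr)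
qed

text \<open>The parameter \<open>x\<close> will be the number of units held. Joint measurability is
  required because conditioning later inserts a random number of units together with a random
  price.\<close>

lemma markov_expect_measurable:
  fixes g :: "'b \<Rightarrow> (nat \<Rightarrow> real) \<Rightarrow> real"
  assumes g: "(\<lambda>(x, p). g x p) \<in> borel_measurable (X \<Otimes>\<^sub>M Pi\<^sub>M UNIV (\<lambda>_. borel))"
    and "\<And>u. t \<le> u \<Longrightarrow> u < t + m \<Longrightarrow> \<kappa> u \<in> measurable borel (subprob_algebra borel)"
  shows "(\<lambda>(x, p). markov_expect \<kappa> m t p (g x)) \<in> borel_measurable (X \<Otimes>\<^sub>M Pi\<^sub>M UNIV (\<lambda>_. borel))"
  using assms(2)
proof (induction m arbitrary: t)
  case 0
  with g show ?case by simp
next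
  case (Suc m)
  let ?XP = "X \<Otimes>\<^sub>M Pi\<^sub>M UNIV (\<lambda>_. borel) :: ('b \<times> (nat \<Rightarrow> real)) measure"
  have IH: "(\<lambda>(x, p). markov_expect \<kappa> m (Suc t) p (g x)) \<in> borel_measurable ?XP"
    by (rule Suc.IH) (use Suc.prems in auto)
  have upd: "(\<lambda>q. (fst (fst q), (snd (fst q))(Suc t := snd q))) \<in> measurable (?XP \<Otimes>\<^sub>M borel) ?XP"
  proof (rule measurable_Pair)
    have "(\<lambda>q. (snd (fst q), snd q)) \<in> measurable (?XP \<Otimes>\<^sub>M borel) (Pi\<^sub>M UNIV (\<lambda>_. borel) \<Otimes>\<^sub>M borel)"
      by measurable
    from measurable_compose[OF this measurable_add_dim[where i = "Suc t" and I = UNIV and M = "\<lambda>_. borel"]]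
    show "(\<lambda>q. (snd (fst q))(Suc t := snd q)) \<in> measurable (?XP \<Otimes>\<^sub>M borel) (Pi\<^sub>M UNIV (\<lambda>_. borel))"
      by simp
  qed measurable
  have "(\<lambda>q. \<integral>y. markov_expect \<kappa> m (Suc t) ((snd q)(Suc t := y)) (g (fst q)) \<partial>\<kappa> t (snd q t))
      \<in> borel_measurable ?XP"
  proof (rule integral_kernel_measurable)
    show "(\<lambda>(q, y). markov_expect \<kappa> m (Suc t) ((snd q)(Suc t := y)) (g (fst q)))
        \<in> borel_measurable (?XP \<Otimes>\<^sub>M borel)"
      using measurable_compose[OF upd IH] by (simp add: split_beta)
    have "\<kappa> t \<in> measurable borel (subprob_algebra borel)"
      using Suc.prems by simp
    then show "(\<lambda>q. \<kappa> t (snd q t)) \<in> measurable ?XP (subprob_algebra borel)"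
      by measurable
  qed
  then show ?case by (simp add: split_beta)
qed

section \<open>The value function: closed forms and one-step recursion\<close>

context markov_price_process
begin

lemma kernel_subprob: "t < N \<Longrightarrow> \<kappa> t \<in> measurable borel (subprob_algebra borel)"
  by (rule measurable_prob_algebraD) (rule kernel)

lemma kernel_real_distribution:
  assumes "t < N" shows "real_distribution (\<kappa> t s)"
proof -
  have "\<kappa> t s \<in> space (prob_algebra borel)"
    using measurable_space[OF kernel[OF assms]] by simp
  then show ?thesis
    by (simp add: space_prob_algebra real_distribution_def real_distribution_axioms_def)
qed

lemma markov_expect_claims_measurable:
  "(\<lambda>(z, p). markov_expect \<kappa> (N - T) T p (\<lambda>p. \<Sum>u=t..N. claim w N (fund_from w t z p) u))
     \<in> borel_measurable (borel \<Otimes>\<^sub>M Pi\<^sub>M UNIV (\<lambda>_. borel))"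
proof (rule markov_expect_measurable)
  show "(\<lambda>(z, p). \<Sum>u=t..N. claim w N (fund_from w t z p) u)
      \<in> borel_measurable (borel \<Otimes>\<^sub>M Pi\<^sub>M UNIV (\<lambda>_. borel))"
    unfolding split_beta
    by (intro borel_measurable_sum claim_measurable fund_from_measurable) measurable
qed (auto intro: kernel_subprob)

lemma value_fun_measurable_pair:
  "(\<lambda>(s, z). value_fun w N \<kappa> t s z) \<in> borel_measurable (borel \<Otimes>\<^sub>M borel)"
proof -
  have "(\<lambda>q. (snd q, \<lambda>_. fst q)) \<in> measurable (borel \<Otimes>\<^sub>M borel)
      (borel \<Otimes>\<^sub>M (Pi\<^sub>M UNIV (\<lambda>_. borel) :: (nat \<Rightarrow> real) measure))"
    by (intro measurable_Pair measurable_PiM_single') (auto simp: space_pair_measure)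
  from measurable_compose[OF this markov_expect_claims_measurable]
  have "(\<lambda>q. value_fun w N \<kappa> t (fst q) (snd q)) \<in> borel_measurable (borel \<Otimes>\<^sub>M borel)"
    unfolding value_fun_def split_beta fst_conv snd_conv .
  then show ?thesis
    unfolding split_beta .
qed

lemma value_fun_measurable: "(\<lambda>s. value_fun w N \<kappa> t s z) \<in> borel_measurable borel"
proof -
  have "(\<lambda>s. (s, z)) \<in> measurable borel (borel \<Otimes>\<^sub>M borel)"
    by measurable
  from measurable_compose[OF this value_fun_measurable_pair] show ?thesis
    unfolding split_beta fst_conv snd_conv .
qed

text \<open>The withdrawal at \<open>t\<close> exhausts the fund, so every continuation pays the
  same: the shortfall \<open>w - z * s\<close> at \<open>t\<close> and \<open>w\<close> at each of
  the \<open>N - t\<close> later dates.\<close>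

lemma value_fun_depleted:
  assumes "0 < t" "t \<le> N" "0 < s" "0 < z" "z * s \<le> w"
  shows "value_fun w N \<kappa> t s z = real (Suc (N - t)) * w - z * s"
  unfolding value_fun_def
proof (rule markov_expect_const)
  show "prob_space (\<kappa> u x)" if "u < t + (N - t)" for u x
    using kernel_real_distribution[of u x] that assms by (simp add: real_distribution_def)
  fix p :: "nat \<Rightarrow> real" assume p: "\<And>u. u \<le> t \<Longrightarrow> p u = s"
  have "fund_from w t z p u = z * s" if "u < t" for u
    using that p \<open>0 < s\<close> by (intro fund_from_before) auto
  moreover have "fund_from w t z p t = z * s - w"
    using p assms by (intro fund_from_at) auto
  ultimately show "(\<Sum>u=t..N. claim w N (fund_from w t z p) u) = real (Suc (N - t)) * w - z * s"
    using assms by (subst sum_claims_at_depletion) (auto simp: algebra_simps)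
qed

lemma value_fun_last:
  assumes "0 < N" "0 < s" "0 < z"
  shows "value_fun w N \<kappa> N s z = max (w - z * s) 0"
proof -
  have before: "fund_from w N z (\<lambda>_. s) u = z * s" if "u < N" for u
    using that assms by (intro fund_from_before) auto
  have at: "fund_from w N z (\<lambda>_. s) N = z * s - w"
    using assms by (intro fund_from_at) auto
  have "claim w N (fund_from w N z (\<lambda>_. s)) N = max (w - z * s) 0"
  proof (cases "z * s \<le> w")
    case True
    then show ?thesis
      using assms before at by (subst claim_at_depletion) auto
  next
    case False
    have "0 < fund_from w N z (\<lambda>_. s) u" if "u \<le> N" for u
      using that before at False assms by (cases "u = N") auto
    with False show ?thesis
      by (subst claim_alive) auto
  qed
  then show ?thesis by (simp add: value_fun_def)
qed

text \<open>The fund survives \<open>t\<close> with the positive amount \<open>z * s - w\<close>,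
  that is, with \<open>z - w / s\<close> units. Nothing is due at \<open>t\<close>, and from
  \<open>Suc t\<close> on it coincides with the fund restarted with that many units.\<close>

lemma value_fun_step:
  assumes "0 \<le> w" "0 < t" "t < N" "0 < s" "w < z * s"
  shows "value_fun w N \<kappa> t s z = (\<integral>y. value_fun w N \<kappa> (Suc t) y (z - w / s) \<partial>\<kappa> t s)"
proof -
  let ?g = "\<lambda>t z p. \<Sum>u=t..N. claim w N (fund_from w t z p) u"
  let ?z = "z - w / s"
  have "0 < ?z" using assms by (simp add: field_simps)
  interpret \<kappa>: real_distribution "\<kappa> t s"
    using assms by (intro kernel_real_distribution)
  from \<open>t < N\<close> have "N - t = Suc (N - Suc t)" by simp
  then have "value_fun w N \<kappa> t s z
      = (\<integral>y. markov_expect \<kappa> (N - Suc t) (Suc t) ((\<lambda>_. s)(Suc t := y)) (?g t z) \<partial>\<kappa> t s)"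
    unfolding value_fun_def by simp
  \<comment> \<open>For \<open>y \<le> 0\<close> the integrands differ: then the fund on the right is depleted before \<open>Suc t\<close>.\<close>
  also have "\<dots> = (\<integral>y. value_fun w N \<kappa> (Suc t) y ?z \<partial>\<kappa> t s)"
  proof (rule integral_cong_AE)
    show "AE y in \<kappa> t s. markov_expect \<kappa> (N - Suc t) (Suc t) ((\<lambda>_. s)(Suc t := y)) (?g t z)
        = value_fun w N \<kappa> (Suc t) y ?z"
      using kernel_positive[OF \<open>t < N\<close> \<open>0 < s\<close>]
    proof eventually_elim
      case (elim y)
      show ?case
        unfolding value_fun_def
      proof (rule markov_expect_cong)
        fix p q :: "nat \<Rightarrow> real"
        assume p: "\<And>u. u \<le> Suc t \<Longrightarrow> p u = ((\<lambda>_. s)(Suc t := y)) u"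
          and q: "\<And>u. u \<le> Suc t \<Longrightarrow> q u = y"
          and eq: "\<And>u. Suc t \<le> u \<Longrightarrow> u \<le> Suc t + (N - Suc t) \<Longrightarrow> p u = q u"
        let ?x = "fund_from w t z p" and ?y = "fund_from w (Suc t) ?z q"
        have "?x u = z * s" if "u < t" for u
          using that p \<open>0 < s\<close> by (intro fund_from_before) auto
        moreover have x_t: "?x t = z * s - w"
          using p assms by (intro fund_from_at) auto
        ultimately have x: "0 < ?x u" if "u \<le> t" for u
          using that \<open>0 \<le> w\<close> \<open>w < z * s\<close> by (cases "u = t") auto
        have y: "0 < ?y u" if "u < Suc t" for u
          using that \<open>0 < ?z\<close> elim q fund_from_before[of u "Suc t" q y w ?z] by simp
        have "?x (Suc t) = (z * s - w) * y / s - w"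
          using p by (simp add: x_t)
        also have "\<dots> = ?z * y - w"
          using \<open>0 < s\<close> by (simp add: field_simps)
        also have "\<dots> = ?y (Suc t)"
          using q elim by (subst fund_from_at[where s = y]) auto
        finally have x_Suc: "?x (Suc t) = ?y (Suc t)" .
        have "?x u = ?y u" if u: "Suc t \<le> u" "u \<le> N" for u
        proof (rule fund_from_cong[OF u(1)])
          show "p i = q i" if "Suc t \<le> i" "i \<le> u" for i
            using eq[of i] that u(2) by simp
        qed (use x_Suc in simp_all)
        then have "claim w N ?x i = claim w N ?y i" if "i \<in> {Suc t..N}" for i
          using that x y by (intro claim_cong[where t = "Suc t"]) simp_all
        then show "?g t z p = ?g (Suc t) ?z q"
          using sum_claims_alive[of t ?x N w] x \<open>t < N\<close> by simp
      qed simp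
    qed
    have "(\<lambda>y. (z, (\<lambda>_. s)(Suc t := y))) \<in> measurable borel
        (borel \<Otimes>\<^sub>M (Pi\<^sub>M UNIV (\<lambda>_. borel) :: (nat \<Rightarrow> real) measure))"
      by (intro measurable_Pair measurable_PiM_single') (auto simp: fun_upd_def)
    from measurable_compose[OF this markov_expect_claims_measurable]
    show "(\<lambda>y. markov_expect \<kappa> (N - Suc t) (Suc t) ((\<lambda>_. s)(Suc t := y)) (?g t z))
        \<in> borel_measurable (\<kappa> t s)"
      by simp
    show "(\<lambda>y. value_fun w N \<kappa> (Suc t) y ?z) \<in> borel_measurable (\<kappa> t s)"
      by (simp add: value_fun_measurable)
  qed
  finally show ?thesis .
qed

end

section \<open>The guarantee value as a conditional expectation\<close>

context markov_price_process
begin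

lemma finite_measure_subalgebra_F: "finite_measure_subalgebra M (F t)"
  by unfold_locales (rule subalgebra_F)

lemma S_measurable_F: "u \<le> t \<Longrightarrow> u \<le> N \<Longrightarrow> S u \<in> borel_measurable (F t)"
  using S_adapted[of u] sets_F_mono[of u t] by (auto simp: measurable_def space_F)

lemma F_measurable: "f \<in> borel_measurable (F t) \<Longrightarrow> f \<in> borel_measurable M"
  by (rule measurable_from_subalg[OF subalgebra_F])

lemma S_measurable: "u \<le> N \<Longrightarrow> S u \<in> borel_measurable M"
  using S_adapted F_measurable by blast

lemma kernel_price_measurable:
  assumes "t < N"
  shows "(\<lambda>\<omega>. \<kappa> t (S t \<omega>)) \<in> measurable (F t) (subprob_algebra borel)"
  using measurable_compose[OF S_adapted kernel_subprob] assms by simp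

lemma measurable_pair_next_price:
  assumes "t < N"
  shows "(\<lambda>\<omega>. (\<omega>, S (Suc t) \<omega>)) \<in> measurable M (F t \<Otimes>\<^sub>M borel)"
proof (rule measurable_Pair)
  show "(\<lambda>\<omega>. \<omega>) \<in> measurable M (F t)"
    using subalgebra_F[of t] by (auto simp: measurable_def subalgebra_def)
  show "S (Suc t) \<in> borel_measurable M"
    using S_measurable[of "Suc t"] assms by simp
qed

lemma measurable_distr_pair_kernel:
  assumes "t < N"
  shows "(\<lambda>\<omega>. distr (\<kappa> t (S t \<omega>)) (F t \<Otimes>\<^sub>M borel) (Pair \<omega>))
           \<in> measurable (restr_to_subalg M (F t)) (subprob_algebra (F t \<Otimes>\<^sub>M borel))"
proof (rule measurable_distr2)
  let ?R = "restr_to_subalg M (F t)"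
  have sets_R: "sets ?R = sets (F t)"
    by (rule sets_restr_to_subalg[OF subalgebra_F])
  then show "(\<lambda>\<omega>. \<kappa> t (S t \<omega>)) \<in> measurable ?R (subprob_algebra borel)"
    using kernel_price_measurable[OF assms] by (simp cong: measurable_cong_sets)
  have "sets (?R \<Otimes>\<^sub>M (borel :: real measure)) = sets (F t \<Otimes>\<^sub>M borel)"
    using sets_R by (intro sets_pair_measure_cong) auto
  then show "case_prod Pair \<in> measurable (?R \<Otimes>\<^sub>M (borel :: real measure)) (F t \<Otimes>\<^sub>M borel)"
    by (simp cong: measurable_cong_sets)
qed

text \<open>On a rectangle \<open>A \<times> B\<close> this is the Markov property for the set
  \<open>B\<close>, integrated over \<open>A\<close>. Rectangles form an intersection-stable
  generator, so the two measures agree.\<close>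

lemma joint_law_eq_bind:
  assumes "t < N"
  shows "distr M (F t \<Otimes>\<^sub>M borel) (\<lambda>\<omega>. (\<omega>, S (Suc t) \<omega>))
       = restr_to_subalg M (F t) \<bind> (\<lambda>\<omega>. distr (\<kappa> t (S t \<omega>)) (F t \<Otimes>\<^sub>M borel) (Pair \<omega>))"
    (is "?\<nu> = ?\<mu>")
proof -
  interpret F: finite_measure_subalgebra M "F t"
    by (rule finite_measure_subalgebra_F)
  let ?R = "restr_to_subalg M (F t)"
  have space_R: "space ?R = space M"
    by (simp add: space_restr_to_subalg)
  have S': "S (Suc t) \<in> borel_measurable M"
    using S_measurable[of "Suc t"] assms by simp
  note pair = measurable_pair_next_price[OF assms]
  note K' = measurable_distr_pair_kernel[OF assms]
  have nonempty: "space ?R \<noteq> {}"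
    using not_empty space_R by simp
  let ?E = "{A \<times> B |A B. A \<in> sets (F t) \<and> B \<in> sets (borel :: real measure)}"
  let ?\<Omega> = "space (F t) \<times> space (borel :: real measure)"
  have eq: "emeasure ?\<nu> (A \<times> B) = emeasure ?\<mu> (A \<times> B)"
    if A: "A \<in> sets (F t)" and B: "B \<in> sets borel" for A and B :: "real set"
  proof -
    have AM: "A \<in> sets M"
      using A subalgebra_F[of t] by (auto simp: subalgebra_def)
    have prob: "real_distribution (\<kappa> t (S t \<omega>))" for \<omega>
      by (rule kernel_real_distribution[OF assms])
    have meas_B: "(\<lambda>\<omega>. measure (\<kappa> t (S t \<omega>)) B) \<in> borel_measurable (F t)"
      using measurable_compose[OF kernel_price_measurable[OF assms] measurable_measure_subprob_algebra[OF B]] .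
    have int_B: "integrable M (\<lambda>\<omega>. indicator B (S (Suc t) \<omega>) :: real)"
      by (rule integrable_const_bound[where B = 1]) (use S' B in \<open>auto intro: measurable_compose\<close>)
    have le_1: "measure (\<kappa> t (S t \<omega>)) B \<le> 1" for \<omega>
      using prob[of \<omega>] by (simp add: real_distribution_def prob_space.prob_le_1)
    have int_K: "integrable M (\<lambda>\<omega>. indicator A \<omega> * measure (\<kappa> t (S t \<omega>)) B)"
      by (rule integrable_const_bound[where B = 1])
        (use AM F_measurable[OF meas_B] le_1 in \<open>auto intro!: mult_le_one simp: abs_mult\<close>)
    have "emeasure ?\<nu> (A \<times> B) = emeasure M (A \<inter> (S (Suc t) -` B \<inter> space M))"
      using A B sets.sets_into_space[OF AM] by (subst emeasure_distr[OF pair]) (auto intro!: arg_cong[where f = "emeasure M"])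
    also have "\<dots> = ennreal (\<integral>\<omega>. indicator (A \<inter> (S (Suc t) -` B \<inter> space M)) \<omega> \<partial>M)"
      using AM measurable_sets[OF S' B] by (simp add: emeasure_eq_measure sets.Int)
    also have "(\<integral>\<omega>. indicator (A \<inter> (S (Suc t) -` B \<inter> space M)) \<omega> \<partial>M)
        = (LINT \<omega>:A|M. indicator B (S (Suc t) \<omega>))"
      unfolding set_lebesgue_integral_def
      by (rule Bochner_Integration.integral_cong) (auto split: split_indicator)
    also have "\<dots> = (LINT \<omega>:A|M. real_cond_exp M (F t) (\<lambda>\<omega>. indicator B (S (Suc t) \<omega>)) \<omega>)"
      by (rule F.real_cond_exp_intA[OF int_B A])
    also have "\<dots> = (\<integral>\<omega>. indicator A \<omega> * measure (\<kappa> t (S t \<omega>)) B \<partial>M)"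
      unfolding set_lebesgue_integral_def
    proof (rule integral_cong_AE)
      show "AE \<omega> in M. indicator A \<omega> *\<^sub>R real_cond_exp M (F t) (\<lambda>\<omega>. indicator B (S (Suc t) \<omega>)) \<omega>
          = indicator A \<omega> * measure (\<kappa> t (S t \<omega>)) B"
        using markov[OF assms B] by eventually_elim simp
    qed (use AM F_measurable[OF meas_B] in auto)
    also have "ennreal \<dots> = (\<integral>\<^sup>+\<omega>. ennreal (indicator A \<omega> * measure (\<kappa> t (S t \<omega>)) B) \<partial>M)"
      using int_K by (subst nn_integral_eq_integral) auto
    also have "\<dots> = (\<integral>\<^sup>+\<omega>. ennreal (indicator A \<omega> * measure (\<kappa> t (S t \<omega>)) B) \<partial>?R)"
      using A meas_B by (intro nn_integral_subalgebra2[OF subalgebra_F, symmetric]) auto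
    also have "\<dots> = (\<integral>\<^sup>+\<omega>. emeasure (distr (\<kappa> t (S t \<omega>)) (F t \<Otimes>\<^sub>M borel) (Pair \<omega>)) (A \<times> B) \<partial>?R)"
    proof (rule nn_integral_cong)
      fix \<omega> assume "\<omega> \<in> space ?R"
      then have "\<omega> \<in> space (F t)" using space_R space_F by simp
      interpret \<kappa>: real_distribution "\<kappa> t (S t \<omega>)" by (rule prob)
      have "Pair \<omega> \<in> measurable (\<kappa> t (S t \<omega>)) (F t \<Otimes>\<^sub>M borel)"
        using \<open>\<omega> \<in> space (F t)\<close> by (simp cong: measurable_cong_sets)
      then have "emeasure (distr (\<kappa> t (S t \<omega>)) (F t \<Otimes>\<^sub>M borel) (Pair \<omega>)) (A \<times> B)
          = emeasure (\<kappa> t (S t \<omega>)) (Pair \<omega> -` (A \<times> B))"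
        using A B by (subst emeasure_distr) auto
      also have "Pair \<omega> -` (A \<times> B) = (if \<omega> \<in> A then B else {})"
        by auto
      finally show "ennreal (indicator A \<omega> * measure (\<kappa> t (S t \<omega>)) B)
          = emeasure (distr (\<kappa> t (S t \<omega>)) (F t \<Otimes>\<^sub>M borel) (Pair \<omega>)) (A \<times> B)"
        by (simp add: \<kappa>.emeasure_eq_measure)
    qed
    also have "\<dots> = emeasure ?\<mu> (A \<times> B)"
      using A B by (intro emeasure_bind[OF nonempty K', symmetric]) auto
    finally show ?thesis .
  qed
  show ?thesis
  proof (rule measure_eqI_generator_eq)
    show "Int_stable ?E" by (rule Int_stable_pair_measure_generator)
    show "?E \<subseteq> Pow ?\<Omega>" by (rule pair_measure_closed)
    show "sets ?\<nu> = sigma_sets ?\<Omega> ?E"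
      by (simp add: sets_pair_measure)
    show "sets ?\<mu> = sigma_sets ?\<Omega> ?E"
      using sets_bind[OF sets_kernel[OF K'] nonempty] by (simp add: sets_pair_measure)
    show "range (\<lambda>_::nat. ?\<Omega>) \<subseteq> ?E" by blast
    show "(\<Union>i::nat. ?\<Omega>) = ?\<Omega>" by simp
    show "emeasure ?\<nu> ?\<Omega> \<noteq> \<infinity>" for i :: nat
      using prob_space.emeasure_le_1[OF prob_space_distr[OF pair], of ?\<Omega>] by (auto simp: top_unique)
    show "emeasure ?\<nu> X = emeasure ?\<mu> X" if "X \<in> ?E" for X
      using that eq by auto
  qed
qed

text \<open>Freezing: a quantity known at \<open>t\<close> is held fixed while the next price is
  integrated out. Both sides have equal integrals over each event of \<open>F t\<close>, by
  computing one integral under the joint law and under its disintegration.\<close>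

lemma real_cond_exp_next_price:
  fixes f :: "real \<Rightarrow> real \<Rightarrow> real"
  assumes "t < N" and Z: "Z \<in> borel_measurable (F t)"
    and f: "(\<lambda>(y, z). f y z) \<in> borel_measurable (borel \<Otimes>\<^sub>M borel)"
    and bounds: "\<And>y z. 0 \<le> f y z" "\<And>y z. f y z \<le> B"
  shows "AE \<omega> in M. real_cond_exp M (F t) (\<lambda>\<omega>. f (S (Suc t) \<omega>) (Z \<omega>)) \<omega>
           = (\<integral>y. f y (Z \<omega>) \<partial>\<kappa> t (S t \<omega>))"
proof -
  interpret F: finite_measure_subalgebra M "F t"
    by (rule finite_measure_subalgebra_F)
  let ?R = "restr_to_subalg M (F t)"
  note pair = measurable_pair_next_price[OF \<open>t < N\<close>]
  have fZ: "(\<lambda>q. f (snd q) (Z (fst q))) \<in> borel_measurable (F t \<Otimes>\<^sub>M borel)"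
  proof -
    have "(\<lambda>q. (snd q, Z (fst q))) \<in> measurable (F t \<Otimes>\<^sub>M borel) (borel \<Otimes>\<^sub>M borel)"
      using Z by measurable
    from measurable_compose[OF this f] show ?thesis by simp
  qed
  define g where "g \<omega> = (\<integral>y. f y (Z \<omega>) \<partial>\<kappa> t (S t \<omega>))" for \<omega>
  have g_meas: "g \<in> borel_measurable (F t)"
    unfolding g_def
    by (rule integral_kernel_measurable[OF _ kernel_price_measurable[OF \<open>t < N\<close>]])
      (use fZ in \<open>simp add: split_beta\<close>)
  have int_f: "integrable (\<kappa> t s) (\<lambda>y. f y z)" for s z
  proof -
    interpret \<kappa>: real_distribution "\<kappa> t s"
      by (rule kernel_real_distribution[OF \<open>t < N\<close>])
    have "(\<lambda>y. (y, z)) \<in> measurable borel (borel \<Otimes>\<^sub>M borel)"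
      by measurable
    from measurable_compose[OF this f] have "(\<lambda>y. f y z) \<in> borel_measurable borel"
      by simp
    then show ?thesis
      by (intro \<kappa>.integrable_const_bound[where B = B] AE_I2 \<kappa>.measurable_finite_borel) (use bounds in auto)
  qed
  have g_bounds: "0 \<le> g \<omega>" "g \<omega> \<le> B" for \<omega>
  proof -
    interpret \<kappa>: real_distribution "\<kappa> t (S t \<omega>)"
      by (rule kernel_real_distribution[OF \<open>t < N\<close>])
    show "0 \<le> g \<omega>" unfolding g_def by (simp add: bounds)
    have "g \<omega> \<le> (\<integral>y. B \<partial>\<kappa> t (S t \<omega>))"
      unfolding g_def by (rule integral_mono) (use bounds int_f in auto)
    then show "g \<omega> \<le> B" using \<kappa>.prob_space by simp
  qed
  have fS_meas: "(\<lambda>\<omega>. f (S (Suc t) \<omega>) (Z \<omega>)) \<in> borel_measurable M"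
    using measurable_compose[OF pair fZ] by simp
  have int_fS: "integrable M (\<lambda>\<omega>. f (S (Suc t) \<omega>) (Z \<omega>))"
    by (intro integrable_const_bound[where B = B] AE_I2 fS_meas) (use bounds in auto)
  have int_g: "integrable M g"
    by (intro integrable_const_bound[where B = B] AE_I2 F_measurable[OF g_meas]) (use g_bounds in auto)
  have "AE \<omega> in M. real_cond_exp M (F t) (\<lambda>\<omega>. f (S (Suc t) \<omega>) (Z \<omega>)) \<omega> = g \<omega>"
  proof (rule F.real_cond_exp_charact[OF _ int_fS int_g g_meas])
    fix A assume A: "A \<in> sets (F t)"
    then have AM: "A \<in> sets M"
      using subalgebra_F[of t] by (auto simp: subalgebra_def)
    \<comment> \<open>The integrand becomes a nonnegative function on pairs, to which the
      nonnegative integral rule for \<open>bind\<close> applies.\<close>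
    define h where "h q = indicator A (fst q) * ennreal (f (snd q) (Z (fst q)))" for q
    have h: "h \<in> borel_measurable (F t \<Otimes>\<^sub>M borel)"
      unfolding h_def using fZ A by measurable
    have "(\<integral>\<^sup>+\<omega>. ennreal (indicator A \<omega> * f (S (Suc t) \<omega>) (Z \<omega>)) \<partial>M)
        = (\<integral>\<^sup>+\<omega>. h (\<omega>, S (Suc t) \<omega>) \<partial>M)"
      by (rule nn_integral_cong) (auto simp: h_def split: split_indicator)
    also have "\<dots> = (\<integral>\<^sup>+q. h q \<partial>distr M (F t \<Otimes>\<^sub>M borel) (\<lambda>\<omega>. (\<omega>, S (Suc t) \<omega>)))"
      using h by (intro nn_integral_distr[OF pair, symmetric]) simp
    also have "\<dots> = (\<integral>\<^sup>+\<omega>. \<integral>\<^sup>+q. h q \<partial>distr (\<kappa> t (S t \<omega>)) (F t \<Otimes>\<^sub>M borel) (Pair \<omega>) \<partial>?R)"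
      unfolding joint_law_eq_bind[OF \<open>t < N\<close>] by (rule nn_integral_bind[OF h measurable_distr_pair_kernel[OF \<open>t < N\<close>]])
    also have "\<dots> = (\<integral>\<^sup>+\<omega>. ennreal (indicator A \<omega> * g \<omega>) \<partial>?R)"
    proof (rule nn_integral_cong)
      fix \<omega> assume "\<omega> \<in> space ?R"
      then have "\<omega> \<in> space (F t)" by (simp add: space_restr_to_subalg space_F)
      interpret \<kappa>: real_distribution "\<kappa> t (S t \<omega>)"
        by (rule kernel_real_distribution[OF \<open>t < N\<close>])
      have "Pair \<omega> \<in> measurable (\<kappa> t (S t \<omega>)) (F t \<Otimes>\<^sub>M borel)"
        using \<open>\<omega> \<in> space (F t)\<close> by (simp cong: measurable_cong_sets)
      then have "(\<integral>\<^sup>+q. h q \<partial>distr (\<kappa> t (S t \<omega>)) (F t \<Otimes>\<^sub>M borel) (Pair \<omega>))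
          = (\<integral>\<^sup>+y. indicator A \<omega> * ennreal (f y (Z \<omega>)) \<partial>\<kappa> t (S t \<omega>))"
        using h by (subst nn_integral_distr) (auto simp: h_def)
      also have "\<dots> = (\<integral>\<^sup>+y. ennreal (indicator A \<omega> * f y (Z \<omega>)) \<partial>\<kappa> t (S t \<omega>))"
        by (rule nn_integral_cong) (auto split: split_indicator)
      also have "\<dots> = ennreal (indicator A \<omega> * g \<omega>)"
        unfolding g_def using int_f bounds by (subst nn_integral_eq_integral) auto
      finally show "(\<integral>\<^sup>+q. h q \<partial>distr (\<kappa> t (S t \<omega>)) (F t \<Otimes>\<^sub>M borel) (Pair \<omega>))
          = ennreal (indicator A \<omega> * g \<omega>)" .
    qed
    also have "\<dots> = (\<integral>\<^sup>+\<omega>. ennreal (indicator A \<omega> * g \<omega>) \<partial>M)"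
      using A g_meas by (intro nn_integral_subalgebra2[OF subalgebra_F]) auto
    finally have eq: "(\<integral>\<^sup>+\<omega>. ennreal (indicator A \<omega> * f (S (Suc t) \<omega>) (Z \<omega>)) \<partial>M)
        = (\<integral>\<^sup>+\<omega>. ennreal (indicator A \<omega> * g \<omega>) \<partial>M)" .
    show "(LINT \<omega>:A|M. f (S (Suc t) \<omega>) (Z \<omega>)) = (LINT \<omega>:A|M. g \<omega>)"
      unfolding set_lebesgue_integral_def real_scaleR_def
      using eq AM fS_meas F_measurable[OF g_meas] bounds g_bounds
      by (subst (1 2) integral_eq_nn_integral) auto
  qed
  then show ?thesis by (simp add: g_def)
qed

end

context markov_price_process
begin

text \<open>Backward induction from \<open>N\<close>, with at most \<open>w\<close> due per date.
  The bound is uniform over positive states, as conditioning on the next price requires.\<close>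

lemma value_fun_bounds:
  assumes "0 \<le> w" "0 < t" "t \<le> N" "0 < s" "0 < z"
  shows "0 \<le> value_fun w N \<kappa> t s z \<and> value_fun w N \<kappa> t s z \<le> real (Suc (N - t)) * w"
  using assms(3,2,4,5)
proof (induction arbitrary: s z rule: inc_induct)
  case base
  then show ?case
    using \<open>0 \<le> w\<close> by (auto simp: value_fun_last)
next
  case (step t)
  show ?case
  proof (cases "z * s \<le> w")
    case True
    have "0 \<le> real (N - t) * w" using \<open>0 \<le> w\<close> by simp
    with True step show ?thesis
      using mult_pos_pos[of z s] by (simp add: value_fun_depleted algebra_simps)
  next
    case False
    let ?z = "z - w / s"
    interpret \<kappa>: real_distribution "\<kappa> t s"
      using step by (intro kernel_real_distribution) simp
    have "0 < ?z" using False step by (simp add: field_simps)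
    have ae: "AE y in \<kappa> t s. 0 \<le> value_fun w N \<kappa> (Suc t) y ?z
        \<and> value_fun w N \<kappa> (Suc t) y ?z \<le> real (N - t) * w"
      using kernel_positive[OF step.hyps(2) step.prems(2)]
    proof eventually_elim
      case (elim y)
      then show ?case
        using step.IH[of y ?z] step.hyps \<open>0 < ?z\<close> by (simp add: Suc_diff_Suc)
    qed
    have "AE y in \<kappa> t s. norm (value_fun w N \<kappa> (Suc t) y ?z) \<le> real (N - t) * w"
      using ae by eventually_elim simp
    then have int: "integrable (\<kappa> t s) (\<lambda>y. value_fun w N \<kappa> (Suc t) y ?z)"
      by (rule \<kappa>.integrable_const_bound) (simp add: value_fun_measurable)
    have "(\<integral>y. value_fun w N \<kappa> (Suc t) y ?z \<partial>\<kappa> t s) \<le> (\<integral>y. real (N - t) * w \<partial>\<kappa> t s)"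
      by (rule integral_mono_AE[OF int]) (use ae in \<open>auto elim!: eventually_mono\<close>)
    also have "\<dots> \<le> real (Suc (N - t)) * w"
      using \<kappa>.prob_space \<open>0 \<le> w\<close> by (simp add: algebra_simps)
    finally show ?thesis
      using False step ae \<open>0 \<le> w\<close>
      by (auto simp: value_fun_step intro!: integral_nonneg_AE elim!: eventually_mono)
  qed
qed

end

section \<open>The guarantee along the actual fund\<close>

locale withdrawal_fund = markov_price_process M F S N \<kappa>
  for M :: "'a measure" and F :: "nat \<Rightarrow> 'a measure" and S :: "nat \<Rightarrow> 'a \<Rightarrow> real" and N :: nat
    and \<kappa> :: "nat \<Rightarrow> real \<Rightarrow> real measure" +
  fixes w X0 :: real
  assumes w_pos: "0 < w" and X0_pos: "0 < X0"
begin

definition X :: "nat \<Rightarrow> 'a \<Rightarrow> real" where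
  "X t \<omega> = fund w X0 (\<lambda>u. S u \<omega>) t"

definition claims_from :: "nat \<Rightarrow> 'a \<Rightarrow> real" where
  "claims_from t \<omega> = (\<Sum>u=t..N. claim w N (\<lambda>i. X i \<omega>) u)"

text \<open>For \<open>t \<le> N\<close> this is the event \<tau> \<ge> t, written without the
  infimum.\<close>

definition alive :: "nat \<Rightarrow> 'a \<Rightarrow> bool" where
  "alive t \<omega> \<longleftrightarrow> (\<forall>u<t. 0 < X u \<omega>)"

lemma X_0 [simp]: "X 0 \<omega> = X0"
  by (simp add: X_def)

lemma X_Suc: "X (Suc t) \<omega> = X t \<omega> * S (Suc t) \<omega> / S t \<omega> - w"
  by (simp add: X_def)

lemma X_measurable_F: "u \<le> t \<Longrightarrow> u \<le> N \<Longrightarrow> X u \<in> borel_measurable (F t)"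
  unfolding X_def by (intro fund_measurable S_measurable_F) auto

lemma X_measurable: "u \<le> N \<Longrightarrow> X u \<in> borel_measurable M"
  using X_measurable_F F_measurable by blast

lemma alive_Suc: "alive (Suc t) \<omega> \<longleftrightarrow> alive t \<omega> \<and> 0 < X t \<omega>"
  by (auto simp: alive_def less_Suc_eq)

text \<open>The case \<open>t = Suc s\<close> matters: whether the fund is alive at a date is known
  one date earlier, so the indicator of \<open>alive (Suc t)\<close> can be taken out of a
  conditional expectation given \<open>F t\<close>.\<close>

lemma alive_measurable_F:
  assumes "t \<le> Suc s" "s \<le> N" shows "Measurable.pred (F s) (alive t)"
  using assms
proof (induction t)
  case 0
  then show ?case by (simp add: alive_def)
next
  case (Suc t)
  then have [measurable]: "Measurable.pred (F s) (alive t)" "X t \<in> borel_measurable (F s)"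
    by (auto intro: X_measurable_F)
  show ?case unfolding alive_Suc by measurable
qed

lemma S_positive_all: "AE \<omega> in M. \<forall>u\<le>N. 0 < S u \<omega>"
proof -
  have "AE \<omega> in M. \<forall>u\<in>{..N}. 0 < S u \<omega>"
    by (subst AE_finite_all) (auto intro: S_positive)
  then show ?thesis by (simp add: Ball_def)
qed

lemma claims_from_measurable: "claims_from t \<in> borel_measurable M"
  unfolding claims_from_def by (intro borel_measurable_sum claim_measurable X_measurable) simp

lemma claims_from_integrable: "integrable M (claims_from t)"
proof (rule integrable_const_bound[OF _ claims_from_measurable])
  show "AE \<omega> in M. norm (claims_from t \<omega>) \<le> real (Suc N - t) * w"
    using S_positive_all
  proof eventually_elim
    case (elim \<omega>)
    have "- w \<le> X (Suc u) \<omega>" if "u < N" "0 < X u \<omega>" for u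
      using elim[rule_format, of u] elim[rule_format, of "Suc u"] that by (simp add: X_Suc)
    with w_pos show ?case
      using sum_claims_bounds[of w N "\<lambda>i. X i \<omega>" t] by (simp add: claims_from_def)
  qed
qed

text \<open>Separates what is already known at \<open>t\<close> from the random remainder, which is
  present only if the fund survives \<open>t\<close>.\<close>

lemma claims_from_cases:
  assumes "t \<le> N"
  shows "claims_from t \<omega> =
    (if alive (Suc t) \<omega> then claims_from (Suc t) \<omega>
     else if alive t \<omega> then real (N - t) * w - X t \<omega> else real (Suc N - t) * w)"
proof (cases "alive t \<omega>")
  case True
  show ?thesis
  proof (cases "0 < X t \<omega>")
    case pos: True
    with True have "0 < X u \<omega>" if "u \<le> t" for u
      using that by (cases "u = t") (auto simp: alive_def)
    with True pos assms show ?thesis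
      by (simp add: claims_from_def sum_claims_alive alive_Suc)
  next
    case False
    moreover have "0 < t" using False X0_pos by (cases t) auto
    moreover have "0 < X u \<omega>" if "u < t" for u
      using that True by (simp add: alive_def)
    ultimately show ?thesis
      using True assms by (simp add: claims_from_def sum_claims_at_depletion alive_Suc)
  qed
next
  case False
  then obtain u where "u < t" "X u \<omega> \<le> 0" by (auto simp: alive_def not_less)
  with False assms show ?thesis
    using sum_claims_depleted[of u t N "\<lambda>i. X i \<omega>" w] by (simp add: claims_from_def alive_Suc)
qed

text \<open>The candidate for the conditional expectation of \<open>claims_from t\<close> at dates
  \<open>t \<ge> 1\<close>; the quotient is \<zeta> one date earlier.\<close>

definition guarantee :: "nat \<Rightarrow> 'a \<Rightarrow> real" where
  "guarantee t \<omega> = (if alive t \<omega> then value_fun w N \<kappa> t (S t \<omega>) (X (t - 1) \<omega> / S (t - 1) \<omega>)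
     else real (Suc N - t) * w)"

text \<open>The tower property: the part \<open>R\<close> known at \<open>t\<close> is split off,
  the remainder is conditioned first on \<open>F (Suc t)\<close>, where \<open>guarantee\<close>
  describes it, and then the next price is integrated out. The case \<open>t = 0\<close> is included
  and yields the initial value.\<close>

lemma cond_exp_claims_step:
  assumes "t < N"
    and next_value: "AE \<omega> in M. real_cond_exp M (F (Suc t)) (claims_from (Suc t)) \<omega> = guarantee (Suc t) \<omega>"
  shows "AE \<omega> in M. real_cond_exp M (F t) (claims_from t) \<omega> =
    (if alive (Suc t) \<omega> then \<integral>y. value_fun w N \<kappa> (Suc t) y (X t \<omega> / S t \<omega>) \<partial>\<kappa> t (S t \<omega>)
     else if alive t \<omega> then real (N - t) * w - X t \<omega> else real (Suc N - t) * w)"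
proof -
  interpret Ft: finite_measure_subalgebra M "F t"
    by (rule finite_measure_subalgebra_F)
  let ?E = "real_cond_exp M (F t)" and ?E' = "real_cond_exp M (F (Suc t))"
  let ?C' = "claims_from (Suc t)"
  define D where "D \<omega> = (of_bool (alive (Suc t) \<omega>) :: real)" for \<omega>
  \<comment> \<open>Setting \<open>Z\<close> to 0 on depleted paths, where \<open>f\<close>
    vanishes, absorbs the indicator \<open>D\<close> into \<open>f\<close>. The cut-off in
    \<open>f\<close> also makes its bounds hold for all real arguments.\<close>
  define Z where "Z \<omega> = D \<omega> * (X t \<omega> / S t \<omega>)" for \<omega>
  define f where "f y z = of_bool (0 < y \<and> 0 < z) * value_fun w N \<kappa> (Suc t) y z" for y z
  define R where "R \<omega> = (if alive (Suc t) \<omega> then 0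
      else if alive t \<omega> then real (N - t) * w - X t \<omega> else real (Suc N - t) * w)" for \<omega>
  have [measurable]: "Measurable.pred (F t) (alive (Suc t))" "Measurable.pred (F t) (alive t)"
    "X t \<in> borel_measurable (F t)" "S t \<in> borel_measurable (F t)"
    using \<open>t < N\<close> by (auto intro: alive_measurable_F X_measurable_F S_measurable_F)
  have D_meas: "D \<in> borel_measurable (F t)" and Z_meas: "Z \<in> borel_measurable (F t)"
    and R_meas: "R \<in> borel_measurable (F t)"
    unfolding D_def[abs_def] Z_def[abs_def] R_def[abs_def] by measurable
  have int_C': "integrable M ?C'" and int_C: "integrable M (claims_from t)"
    by (rule claims_from_integrable)+
  have int_DC': "integrable M (\<lambda>\<omega>. D \<omega> * ?C' \<omega>)"
    by (rule Bochner_Integration.integrable_bound[OF int_C'],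
        rule borel_measurable_times[OF F_measurable[OF D_meas] claims_from_measurable])
      (simp add: D_def)
  have int_EC': "integrable M (?E' ?C')"
    using finite_measure_subalgebra_F[of "Suc t"] int_C'
    by (intro sigma_finite_subalgebra.real_cond_exp_int(1))
      (auto intro: finite_measure_subalgebra_is_sigma_finite finite_measure_subalgebra.axioms)
  have int_DEC': "integrable M (\<lambda>\<omega>. D \<omega> * ?E' ?C' \<omega>)"
    by (rule Bochner_Integration.integrable_bound[OF int_EC'],
        rule borel_measurable_times[OF F_measurable[OF D_meas] borel_measurable_integrable[OF int_EC']])
      (simp add: D_def)
  have R_eq: "R \<omega> = claims_from t \<omega> - D \<omega> * ?C' \<omega>" for \<omega>
    using claims_from_cases[of t \<omega>] \<open>t < N\<close> by (simp add: R_def D_def)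
  then have int_R: "integrable M R"
    using int_C int_DC' by (simp add: R_eq[abs_def])
  have C_eq: "claims_from t = (\<lambda>\<omega>. R \<omega> + D \<omega> * ?C' \<omega>)"
    by (simp add: R_eq fun_eq_iff)
  have E1: "AE \<omega> in M. ?E (claims_from t) \<omega> = ?E R \<omega> + ?E (\<lambda>\<omega>. D \<omega> * ?C' \<omega>) \<omega>"
    unfolding C_eq by (rule Ft.real_cond_exp_add[OF int_R int_DC'])
  have E2: "AE \<omega> in M. ?E R \<omega> = R \<omega>"
    by (rule Ft.real_cond_exp_F_meas[OF int_R R_meas])
  \<comment> \<open>\<open>D\<close> is taken out, the tower property is applied to the bare claims,
    and \<open>D\<close> is put back in \<open>E5\<close>: the inner conditional expectation equals
    a value function only where \<open>D\<close> is 1.\<close>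
  have E3: "AE \<omega> in M. ?E (\<lambda>\<omega>. D \<omega> * ?C' \<omega>) \<omega> = D \<omega> * ?E ?C' \<omega>"
    by (rule Ft.real_cond_exp_mult[OF D_meas claims_from_measurable int_DC'])
  have E4: "AE \<omega> in M. ?E (?E' ?C') \<omega> = ?E ?C' \<omega>"
    by (rule Ft.real_cond_exp_nested_subalg[OF subalgebra_F _ int_C'])
      (auto simp: subalgebra_def space_F sets_F_mono)
  have E5: "AE \<omega> in M. ?E (\<lambda>\<omega>. D \<omega> * ?E' ?C' \<omega>) \<omega> = D \<omega> * ?E (?E' ?C') \<omega>"
    by (rule Ft.real_cond_exp_mult[OF D_meas _ int_DEC']) (use int_EC' in auto)
  have f_meas: "(\<lambda>(y, z). f y z) \<in> borel_measurable (borel \<Otimes>\<^sub>M borel)"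
  proof -
    have [measurable]: "(\<lambda>q. value_fun w N \<kappa> (Suc t) (fst q) (snd q)) \<in> borel_measurable (borel \<Otimes>\<^sub>M borel)"
      using value_fun_measurable_pair by (simp add: split_beta)
    show ?thesis unfolding f_def split_beta by measurable
  qed
  have f_bounds: "0 \<le> f y z" "f y z \<le> real (N - t) * w" for y z
    using value_fun_bounds[of w "Suc t" y z] \<open>t < N\<close> w_pos
    by (auto simp: f_def Suc_diff_Suc)
  have "AE \<omega> in M. D \<omega> * ?E' ?C' \<omega> = f (S (Suc t) \<omega>) (Z \<omega>)"
    using next_value S_positive_all
  proof eventually_elim
    case (elim \<omega>)
    show ?case
    proof (cases "alive (Suc t) \<omega>")
      case True
      then have "0 < X t \<omega> / S t \<omega>"
        using elim(2) \<open>t < N\<close> by (simp add: alive_Suc)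
      with True elim \<open>t < N\<close> show ?thesis
        by (simp add: D_def Z_def f_def guarantee_def)
    qed (simp add: D_def Z_def f_def)
  qed
  moreover have "(\<lambda>\<omega>. f (S (Suc t) \<omega>) (Z \<omega>)) \<in> borel_measurable M"
  proof -
    have "(\<lambda>\<omega>. (S (Suc t) \<omega>, Z \<omega>)) \<in> measurable M (borel \<Otimes>\<^sub>M borel)"
      using S_measurable[of "Suc t"] F_measurable[OF Z_meas] \<open>t < N\<close> by (intro measurable_Pair) auto
    from measurable_compose[OF this f_meas] show ?thesis by simp
  qed
  ultimately have E6: "AE \<omega> in M. ?E (\<lambda>\<omega>. D \<omega> * ?E' ?C' \<omega>) \<omega> = ?E (\<lambda>\<omega>. f (S (Suc t) \<omega>) (Z \<omega>)) \<omega>"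
    using int_DEC' by (intro Ft.real_cond_exp_cong) auto
  have E7: "AE \<omega> in M. ?E (\<lambda>\<omega>. f (S (Suc t) \<omega>) (Z \<omega>)) \<omega> = (\<integral>y. f y (Z \<omega>) \<partial>\<kappa> t (S t \<omega>))"
    by (rule real_cond_exp_next_price[OF \<open>t < N\<close> Z_meas f_meas f_bounds])
  show ?thesis
    using E1 E2 E3 E4 E5 E6 E7 S_positive_all
  proof eventually_elim
    case (elim \<omega>)
    then have *: "?E (claims_from t) \<omega> = R \<omega> + (\<integral>y. f y (Z \<omega>) \<partial>\<kappa> t (S t \<omega>))"
      by simp
    show ?case
    proof (cases "alive (Suc t) \<omega>")
      case True
      let ?z = "X t \<omega> / S t \<omega>"
      interpret \<kappa>: real_distribution "\<kappa> t (S t \<omega>)"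
        by (rule kernel_real_distribution[OF \<open>t < N\<close>])
      have "0 < S t \<omega>" using elim \<open>t < N\<close> by simp
      then have "0 < ?z" using True by (simp add: alive_Suc)
      have "(\<integral>y. f y ?z \<partial>\<kappa> t (S t \<omega>)) = (\<integral>y. value_fun w N \<kappa> (Suc t) y ?z \<partial>\<kappa> t (S t \<omega>))"
      proof (rule integral_cong_AE)
        show "AE y in \<kappa> t (S t \<omega>). f y ?z = value_fun w N \<kappa> (Suc t) y ?z"
          using kernel_positive[OF \<open>t < N\<close> \<open>0 < S t \<omega>\<close>]
          by eventually_elim (use \<open>0 < ?z\<close> in \<open>simp add: f_def\<close>)
        have "(\<lambda>y. f y ?z) \<in> borel_measurable borel"
          using value_fun_measurable[of w "Suc t" ?z] unfolding f_def by measurable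
        then show "(\<lambda>y. f y ?z) \<in> borel_measurable (\<kappa> t (S t \<omega>))" by simp
      qed (simp add: value_fun_measurable)
      with True * show ?thesis by (simp add: R_def Z_def D_def)
    next
      case False
      then show ?thesis using * by (simp add: R_def Z_def D_def f_def)
    qed
  qed
qed

text \<open>Backward induction. On surviving paths the kernel integral of the previous lemma is
  \<open>value_fun_step\<close> read backwards; depletion exactly at \<open>t\<close> is matched by
  \<open>value_fun_depleted\<close>.\<close>

lemma cond_exp_claims:
  assumes "0 < t" "t \<le> N"
  shows "AE \<omega> in M. real_cond_exp M (F t) (claims_from t) \<omega> = guarantee t \<omega>"
  using assms(2,1)
proof (induction rule: inc_induct)
  case base
  interpret FN: finite_measure_subalgebra M "F N"
    by (rule finite_measure_subalgebra_F)
  have "claims_from N \<in> borel_measurable (F N)"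
    unfolding claims_from_def by (intro borel_measurable_sum claim_measurable X_measurable_F) auto
  from FN.real_cond_exp_F_meas[OF claims_from_integrable this] S_positive_all
  show ?case
  proof eventually_elim
    case (elim \<omega>)
    obtain n where n: "N = Suc n" using base by (cases N) auto
    have "0 < S N \<omega>" "0 < S n \<omega>" "N - 1 = n" using elim(2) n by auto
    moreover have "X N \<omega> = X n \<omega> / S n \<omega> * S N \<omega> - w"
      using X_Suc[of n \<omega>] n by simp
    moreover have "claims_from (Suc N) \<omega> = 0"
      by (simp add: claims_from_def)
    moreover have "0 < X n \<omega>" if "alive N \<omega>"
      using that n by (simp add: alive_def)
    ultimately show ?case
      using claims_from_cases[of N \<omega>] value_fun_last[of "S N \<omega>" "X n \<omega> / S n \<omega>" w] elim(1) base
      by (auto simp: guarantee_def alive_Suc max_def)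
  qed
next
  case (step t)
  from step have "AE \<omega> in M. real_cond_exp M (F (Suc t)) (claims_from (Suc t)) \<omega> = guarantee (Suc t) \<omega>"
    by simp
  from cond_exp_claims_step[OF step.hyps(2) this] S_positive_all
  show ?case
  proof eventually_elim
    case (elim \<omega>)
    obtain n where n: "t = Suc n" using step by (cases t) auto
    let ?s = "S t \<omega>" and ?z = "X n \<omega> / S n \<omega>"
    have pos: "0 < ?s" "0 < S n \<omega>" using elim n step by auto
    have X_t: "X t \<omega> = ?z * ?s - w"
      using n by (simp add: X_Suc)
    show ?case
    proof (cases "alive t \<omega>")
      case True
      then have "0 < ?z" using n pos by (simp add: alive_Suc)
      show ?thesis
      proof (cases "0 < X t \<omega>")
        case pos_t: True
        have "?z - w / ?s = X t \<omega> / ?s"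
          using pos(1) by (simp add: X_t diff_divide_distrib)
        moreover have "w < ?z * ?s" using pos_t X_t by simp
        ultimately have "value_fun w N \<kappa> t ?s ?z
            = (\<integral>y. value_fun w N \<kappa> (Suc t) y (X t \<omega> / ?s) \<partial>\<kappa> t ?s)"
          using value_fun_step[of w t ?s ?z] step pos w_pos by simp
        with True pos_t elim n show ?thesis
          by (simp add: guarantee_def alive_Suc)
      next
        case False
        then have "value_fun w N \<kappa> t ?s ?z = real (Suc (N - t)) * w - ?z * ?s"
          using X_t step pos \<open>0 < ?z\<close> by (intro value_fun_depleted) auto
        with False True elim n X_t show ?thesis
          by (simp add: guarantee_def alive_Suc algebra_simps)
      qed
    next
      case False
      with elim show ?thesis by (simp add: guarantee_def alive_Suc)
    qed
  qed
qed

end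

section \<open>The recursion in terms of put prices\<close>

context markov_price_process
begin

text \<open>The analytic lemma with threshold \<open>w / z\<close> and slope parameter
  \<open>c = z\<close>; \<open>value_fun_depleted\<close> supplies the affine part. The date
  \<open>t = 0\<close> is allowed, which serves the initial value.\<close>

lemma integral_put_times_value_deriv2:
  assumes "t < N" "0 < w" "0 < s" "0 < z"
    and smooth: "smooth_boundary w N t z (\<lambda>k. value_fun w N \<kappa> (t + 1) k z)"
  shows "((\<lambda>k. put_price \<kappa> t k s * (deriv ^^ 2) (\<lambda>k. value_fun w N \<kappa> (t + 1) k z) k)
           has_integral (\<integral>y. value_fun w N \<kappa> (t + 1) y z \<partial>\<kappa> t s)) {w / z..}"
proof -
  interpret \<kappa>: real_distribution "\<kappa> t s"
    by (rule kernel_real_distribution[OF \<open>t < N\<close>])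
  define a where "a = w / z"
  define v where "v k = value_fun w N \<kappa> (t + 1) k z" for k
  have "0 < a" using assms by (simp add: a_def)
  have sb: "smooth_boundary w N t z v"
    using smooth by (simp add: v_def[abs_def])
  have low: "v k = real (N - t) * w - z * k" if "0 < k" "k \<le> a" for k
    unfolding v_def using that assms
    by (subst value_fun_depleted) (auto simp: a_def field_simps Suc_diff_Suc)
  have v: "(v has_real_derivative deriv v k) (at k)" if "a \<le> k" for k
    using sb that \<open>0 < a\<close> unfolding smooth_boundary_def twice_differentiable_on_def a_def[symmetric]
    by (cases "k = a") (auto simp: DERIV_deriv_iff_real_differentiable)
  have v': "(deriv v has_real_derivative deriv (deriv v) k) (at k)" if "a < k" for k
    using sb that \<open>0 < a\<close> unfolding smooth_boundary_def twice_differentiable_on_def a_def[symmetric]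
    by (auto simp: DERIV_deriv_iff_real_differentiable)
  have cont: "isCont (deriv v) a"
    using sb by (simp add: smooth_boundary_def a_def)
  have deriv_low: "deriv v k = - z" if "0 < k" "k < a" for k
  proof (rule DERIV_imp_deriv)
    have "((\<lambda>k. real (N - t) * w - z * k) has_real_derivative - z) (at k)"
      by (auto intro!: derivative_eq_intros)
    then show "(v has_real_derivative - z) (at k)"
      by (rule has_field_derivative_transform_within_open[where S = "{0<..<a}"])
        (use that low in auto)
  qed
  \<comment> \<open>Smooth fit: continuity of the derivative at the threshold carries the slope of
    the affine part over to \<open>a\<close>.\<close>
  have deriv_a: "deriv v a = - z"
  proof (rule tendsto_unique)
    show "(deriv v \<longlongrightarrow> deriv v a) (at_left a)"
      using cont by (auto simp: isCont_def intro: tendsto_mono[OF at_le])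
    have "eventually (\<lambda>k. k \<in> {0<..<a}) (at_left a)"
      by (rule eventually_at_leftI[OF _ \<open>0 < a\<close>])
    then show "(deriv v \<longlongrightarrow> - z) (at_left a)"
      by (intro tendsto_eventually) (auto elim!: eventually_mono simp: deriv_low)
  qed simp
  have put: "(\<lambda>K. \<integral>y. max (K - y) 0 \<partial>\<kappa> t s) differentiable (at K)" if "0 < K" for K
    using put_smooth_strike[OF \<open>t < N\<close> \<open>0 < s\<close>] that
    by (auto simp: twice_differentiable_on_def put_price_def)
  have linear: "v k = v a + z * (a - k)" if "0 < k" "k \<le> a" for k
    using low[of k] low[of a] that \<open>0 < a\<close> by (simp add: algebra_simps)
  have meas: "v \<in> borel_measurable borel"
    unfolding v_def by (rule value_fun_measurable)
  have lim: "(v \<longlongrightarrow> 0) at_top" "((\<lambda>k. k * deriv v k) \<longlongrightarrow> 0) at_top"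
    using sb by (auto simp: smooth_boundary_def)
  have "((\<lambda>k. (\<integral>y. max (k - y) 0 \<partial>\<kappa> t s) * deriv (deriv v) k)
      has_integral (\<integral>y. v y \<partial>\<kappa> t s)) {a..}"
    by (rule \<kappa>.put_times_second_deriv_has_integral[OF kernel_positive[OF \<open>t < N\<close> \<open>0 < s\<close>]
          put \<open>0 < a\<close> meas linear v v' cont deriv_a lim])
  then show ?thesis
    by (simp add: put_price_def a_def v_def[abs_def] numeral_2_eq_2)
qed

lemma value_fun_before_last:
  assumes "2 \<le> N" "0 \<le> w" "0 < s" "w < z * s"
  shows "value_fun w N \<kappa> (N - 1) s z = (z - w / s) * put_price \<kappa> (N - 1) (w / (z - w / s)) s"
proof -
  let ?z = "z - w / s"
  have "0 < ?z" using assms by (simp add: field_simps)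
  interpret \<kappa>: real_distribution "\<kappa> (N - 1) s"
    using assms by (intro kernel_real_distribution) simp
  have "value_fun w N \<kappa> (N - 1) s z = (\<integral>y. value_fun w N \<kappa> N y ?z \<partial>\<kappa> (N - 1) s)"
    using value_fun_step[of w "N - 1" s z] assms by simp
  also have "\<dots> = (\<integral>y. ?z * max (w / ?z - y) 0 \<partial>\<kappa> (N - 1) s)"
  proof (rule integral_cong_AE)
    have "AE y in \<kappa> (N - 1) s. 0 < y"
      using assms by (intro kernel_positive) auto
    then show "AE y in \<kappa> (N - 1) s. value_fun w N \<kappa> N y ?z = ?z * max (w / ?z - y) 0"
    proof eventually_elim
      case (elim y)
      have "?z * max (w / ?z - y) 0 = max (?z * (w / ?z - y)) (?z * 0)"
        using \<open>0 < ?z\<close> by (simp only: max_mult_distrib_left) simp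
      also have "\<dots> = max (w - ?z * y) 0"
        using \<open>0 < ?z\<close> by (simp add: right_diff_distrib)
      finally show ?case
        using value_fun_last[of y ?z w] elim assms \<open>0 < ?z\<close> by simp
    qed
  qed (rule \<kappa>.measurable_finite_borel, simp add: value_fun_measurable)+
  also have "\<dots> = ?z * put_price \<kappa> (N - 1) (w / ?z) s"
    by (simp add: put_price_def)
  finally show ?thesis .
qed

end

text \<open>Outside one null set all prices are positive, and there the pointwise results for
  \<open>value_fun\<close> are evaluated at the realised price and number of units. The
  identification of \<open>V\<close> and the smoothness hypothesis contribute the remaining null
  sets.\<close>

theorem mainTheorem1:
  fixes M :: "'a measure" and F :: "nat \<Rightarrow> 'a measure" and S :: "nat \<Rightarrow> 'a \<Rightarrow> real"
    and \<kappa> :: "nat \<Rightarrow> real \<Rightarrow> real measure"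
    and N :: nat and w X0 :: real
    and X \<zeta> V :: "nat \<Rightarrow> 'a \<Rightarrow> real" and \<tau> :: "'a \<Rightarrow> enat"
    and P Vf :: "nat \<Rightarrow> real \<Rightarrow> real \<Rightarrow> real"
  defines "X \<equiv> \<lambda>t \<omega>. fund w X0 (\<lambda>u. S u \<omega>) t"
    and "\<zeta> \<equiv> \<lambda>t \<omega>. X t \<omega> / S t \<omega>"
    and "\<tau> \<equiv> \<lambda>\<omega>. depletion N (\<lambda>t. X t \<omega>)"
    and "V \<equiv> \<lambda>t. real_cond_exp M (F t) (\<lambda>\<omega>. \<Sum>u=t..N. claim w N (\<lambda>i. X i \<omega>) u)"
    and "P \<equiv> put_price \<kappa>"
    and "Vf \<equiv> value_fun w N \<kappa>"
  assumes N: "N \<ge> 2" and w: "w > 0" and X0: "X0 > 0"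
    and A1: "markov_price_process M F S N \<kappa>"
    and smooth: "\<forall>t\<in>{0..N-2}. AE \<omega> in M. \<zeta> t \<omega> > 0 \<longrightarrow>
          smooth_boundary w N t (\<zeta> t \<omega>) (\<lambda>k. Vf (t+1) k (\<zeta> t \<omega>))"
  shows
    "(\<forall>t\<in>{1..N}. AE \<omega> in M. \<tau> \<omega> \<ge> enat t \<longrightarrow> V t \<omega> = Vf t (S t \<omega>) (\<zeta> (t-1) \<omega>))
   \<and> (\<forall>t\<in>{1..N-2}.
        (AE \<omega> in M. \<tau> \<omega> < enat t \<longrightarrow> V t \<omega> = real (N - t + 1) * w)
      \<and> (AE \<omega> in M. \<tau> \<omega> \<ge> enat t \<and> S t \<omega> \<le> w / \<zeta> (t-1) \<omega> \<longrightarrow>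
            Vf t (S t \<omega>) (\<zeta> (t-1) \<omega>) = real (N - t + 1) * w - \<zeta> (t-1) \<omega> * S t \<omega>)
      \<and> (AE \<omega> in M. \<tau> \<omega> \<ge> enat t \<and> S t \<omega> > w / \<zeta> (t-1) \<omega> \<longrightarrow>
            ((\<lambda>k. P t k (S t \<omega>) * (deriv ^^ 2) (\<lambda>s. Vf (t+1) s (\<zeta> (t-1) \<omega> - w / S t \<omega>)) k)
              has_integral Vf t (S t \<omega>) (\<zeta> (t-1) \<omega>))
              {w / (\<zeta> (t-1) \<omega> - w / S t \<omega>)..}))
   \<and> (AE \<omega> in M. \<tau> \<omega> \<ge> enat (N-1) \<and> S (N-1) \<omega> > w / \<zeta> (N-2) \<omega> \<longrightarrow>
        Vf (N-1) (S (N-1) \<omega>) (\<zeta> (N-2) \<omega>)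
        = (\<zeta> (N-2) \<omega> - w / S (N-1) \<omega>)
          * P (N-1) (w / (\<zeta> (N-2) \<omega> - w / S (N-1) \<omega>)) (S (N-1) \<omega>))
   \<and> (AE \<omega> in M.
        ((\<lambda>k. P 0 k (S 0 \<omega>) * (deriv ^^ 2) (\<lambda>s. Vf 1 s (\<zeta> 0 \<omega>)) k)
          has_integral V 0 \<omega>) {w / \<zeta> 0 \<omega>..})"
proof -
  interpret markov_price_process M F S N \<kappa>
    by (rule A1)
  interpret W: withdrawal_fund M F S N \<kappa> w X0
    by unfold_locales (fact w X0)+
  have X: "X t \<omega> = W.X t \<omega>" for t \<omega>
    by (simp add: X_def W.X_def)
  have V: "V t = real_cond_exp M (F t) (W.claims_from t)" for t
    by (simp add: V_def W.claims_from_def[abs_def] X)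
  have \<tau>: "enat t \<le> \<tau> \<omega> \<longleftrightarrow> W.alive t \<omega>" if "t \<le> N" for t \<omega>
    using that by (auto simp: \<tau>_def depletion_ge_iff W.alive_def X)
  have guarantee: "AE \<omega> in M. V t \<omega> = W.guarantee t \<omega>" if "1 \<le> t" "t \<le> N" for t
    using W.cond_exp_claims[of t] that by (simp add: V)
  have \<zeta>_pos: "0 < \<zeta> (t - 1) \<omega>"
    if "1 \<le> t" "t \<le> N" "enat t \<le> \<tau> \<omega>" "\<forall>u\<le>N. 0 < S u \<omega>" for t \<omega>
    using that \<tau>[of t \<omega>] by (auto simp: \<zeta>_def X W.alive_def)
  have \<zeta>_step: "\<zeta> t \<omega> = \<zeta> (t - 1) \<omega> - w / S t \<omega>"
    if "1 \<le> t" "t \<le> N" "\<forall>u\<le>N. 0 < S u \<omega>" for t \<omega>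
  proof -
    from that(1) obtain n where n: "t = Suc n" by (cases t) auto
    then have "S t \<omega> \<noteq> 0" "S n \<omega> \<noteq> 0"
      using that by (auto simp: less_imp_neq[symmetric])
    then show ?thesis
      using n by (simp add: \<zeta>_def X W.X_Suc field_simps)
  qed
  \<comment> \<open>A price above the threshold means that the fund survives the withdrawal at
    \<open>t\<close>; then \<open>\<zeta> t\<close> is positive and the smoothness hypothesis can be
    invoked for it.\<close>
  have crossing: "w < \<zeta> (t - 1) \<omega> * S t \<omega> \<and> 0 < \<zeta> t \<omega>"
    if "1 \<le> t" "t \<le> N" "enat t \<le> \<tau> \<omega>" "w / \<zeta> (t - 1) \<omega> < S t \<omega>" "\<forall>u\<le>N. 0 < S u \<omega>" for t \<omega>
  proof -
    have "w < \<zeta> (t - 1) \<omega> * S t \<omega>"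
      using \<zeta>_pos[OF that(1,2,3,5)] that(4) by (simp add: field_simps)
    moreover from this have "w / S t \<omega> < \<zeta> (t - 1) \<omega>"
      using that(2,5) by (simp add: field_simps)
    ultimately show ?thesis
      using \<zeta>_step[OF that(1,2,5)] by simp
  qed
  show ?thesis
  proof (intro conjI ballI)
    fix t assume t: "t \<in> {1..N}"
    then have "AE \<omega> in M. V t \<omega> = W.guarantee t \<omega>"
      by (intro guarantee) auto
    then show "AE \<omega> in M. \<tau> \<omega> \<ge> enat t \<longrightarrow> V t \<omega> = Vf t (S t \<omega>) (\<zeta> (t-1) \<omega>)"
      by eventually_elim (use t in \<open>simp add: \<tau> W.guarantee_def Vf_def \<zeta>_def X\<close>)
  next
    fix t assume "t \<in> {1..N-2}"
    then have t: "1 \<le> t" "t \<le> N" "t < N" "t \<in> {0..N-2}" using N by auto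
    show "AE \<omega> in M. \<tau> \<omega> < enat t \<longrightarrow> V t \<omega> = real (N - t + 1) * w"
      using guarantee[OF t(1,2)]
      by eventually_elim (use t \<tau>[of t] in \<open>auto simp: W.guarantee_def Suc_diff_le simp flip: not_le\<close>)
    show "AE \<omega> in M. \<tau> \<omega> \<ge> enat t \<and> S t \<omega> \<le> w / \<zeta> (t-1) \<omega> \<longrightarrow>
            Vf t (S t \<omega>) (\<zeta> (t-1) \<omega>) = real (N - t + 1) * w - \<zeta> (t-1) \<omega> * S t \<omega>"
      using W.S_positive_all
    proof eventually_elim
      case (elim \<omega>)
      show ?case
      proof
        assume *: "\<tau> \<omega> \<ge> enat t \<and> S t \<omega> \<le> w / \<zeta> (t-1) \<omega>"
        then have "0 < \<zeta> (t-1) \<omega>" using \<zeta>_pos[of t \<omega>] t elim by simp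
        with * elim t show "Vf t (S t \<omega>) (\<zeta> (t-1) \<omega>) = real (N - t + 1) * w - \<zeta> (t-1) \<omega> * S t \<omega>"
          using value_fun_depleted[of t "S t \<omega>" "\<zeta> (t-1) \<omega>" w] by (simp add: Vf_def field_simps)
      qed
    qed
    have "AE \<omega> in M. \<zeta> t \<omega> > 0 \<longrightarrow>
          smooth_boundary w N t (\<zeta> t \<omega>) (\<lambda>k. Vf (t+1) k (\<zeta> t \<omega>))"
      using smooth t(4) by blast
    with W.S_positive_all
    show "AE \<omega> in M. \<tau> \<omega> \<ge> enat t \<and> S t \<omega> > w / \<zeta> (t-1) \<omega> \<longrightarrow>
            ((\<lambda>k. P t k (S t \<omega>) * (deriv ^^ 2) (\<lambda>s. Vf (t+1) s (\<zeta> (t-1) \<omega> - w / S t \<omega>)) k)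
              has_integral Vf t (S t \<omega>) (\<zeta> (t-1) \<omega>))
              {w / (\<zeta> (t-1) \<omega> - w / S t \<omega>)..}"
    proof eventually_elim
      case (elim \<omega>)
      show ?case
      proof
        assume "\<tau> \<omega> \<ge> enat t \<and> S t \<omega> > w / \<zeta> (t-1) \<omega>"
        then have *: "w < \<zeta> (t - 1) \<omega> * S t \<omega>" "0 < \<zeta> t \<omega>"
          using crossing[of t \<omega>] t elim by auto
        have "0 < S t \<omega>" using elim t by simp
        have "Vf t (S t \<omega>) (\<zeta> (t-1) \<omega>) = (\<integral>y. Vf (t+1) y (\<zeta> t \<omega>) \<partial>\<kappa> t (S t \<omega>))"
          using value_fun_step[of w t "S t \<omega>" "\<zeta> (t-1) \<omega>"] * t w \<open>0 < S t \<omega>\<close> \<zeta>_step[OF t(1,2) elim(1)]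
          by (simp add: Vf_def)
        then show "((\<lambda>k. P t k (S t \<omega>) * (deriv ^^ 2) (\<lambda>s. Vf (t+1) s (\<zeta> (t-1) \<omega> - w / S t \<omega>)) k)
              has_integral Vf t (S t \<omega>) (\<zeta> (t-1) \<omega>))
              {w / (\<zeta> (t-1) \<omega> - w / S t \<omega>)..}"
          using integral_put_times_value_deriv2[OF t(3) w \<open>0 < S t \<omega>\<close> *(2)] elim(2) *(2)
          unfolding \<zeta>_step[OF t(1,2) elim(1), symmetric] P_def Vf_def by simp
      qed
    qed
  next
    have "N - 1 - 1 = N - 2" by simp
    show "AE \<omega> in M. \<tau> \<omega> \<ge> enat (N-1) \<and> S (N-1) \<omega> > w / \<zeta> (N-2) \<omega> \<longrightarrow>
        Vf (N-1) (S (N-1) \<omega>) (\<zeta> (N-2) \<omega>)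
        = (\<zeta> (N-2) \<omega> - w / S (N-1) \<omega>)
          * P (N-1) (w / (\<zeta> (N-2) \<omega> - w / S (N-1) \<omega>)) (S (N-1) \<omega>)"
      using W.S_positive_all
    proof eventually_elim
      case (elim \<omega>)
      show ?case
        using crossing[of "N - 1" \<omega>] value_fun_before_last[of w "S (N-1) \<omega>" "\<zeta> (N-2) \<omega>"]
          elim N w unfolding \<open>N - 1 - 1 = N - 2\<close> Vf_def P_def by auto
    qed
  next
    have "0 < N" using N by simp
    have "AE \<omega> in M. real_cond_exp M (F (Suc 0)) (W.claims_from (Suc 0)) \<omega> = W.guarantee (Suc 0) \<omega>"
      using N by (intro W.cond_exp_claims) auto
    \<comment> \<open>No withdrawal takes place at date 0, so \<open>value_fun\<close> does not
      describe that date. The conditioning step from date 1 gives \<open>V 0\<close> directly as a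
      kernel integral.\<close>
    note W.cond_exp_claims_step[OF \<open>0 < N\<close> this]
    moreover have "AE \<omega> in M. \<zeta> 0 \<omega> > 0 \<longrightarrow>
          smooth_boundary w N 0 (\<zeta> 0 \<omega>) (\<lambda>k. Vf (0+1) k (\<zeta> 0 \<omega>))"
      using smooth by (rule bspec) simp
    ultimately show "AE \<omega> in M.
        ((\<lambda>k. P 0 k (S 0 \<omega>) * (deriv ^^ 2) (\<lambda>s. Vf 1 s (\<zeta> 0 \<omega>)) k)
          has_integral V 0 \<omega>) {w / \<zeta> 0 \<omega>..}"
      using W.S_positive_all
    proof eventually_elim
      case (elim \<omega>)
      have "0 < S 0 \<omega>" using elim(3) by simp
      then have "0 < \<zeta> 0 \<omega>" using X0 by (simp add: \<zeta>_def X)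
      have "W.alive (Suc 0) \<omega>" using X0 by (simp add: W.alive_def)
      then have "V 0 \<omega> = (\<integral>y. Vf 1 y (\<zeta> 0 \<omega>) \<partial>\<kappa> 0 (S 0 \<omega>))"
        using elim(1) by (simp add: V Vf_def \<zeta>_def X)
      then show ?case
        using integral_put_times_value_deriv2[OF \<open>0 < N\<close> w \<open>0 < S 0 \<omega>\<close> \<open>0 < \<zeta> 0 \<omega>\<close>]
          elim(2) \<open>0 < \<zeta> 0 \<omega>\<close>
        unfolding P_def Vf_def by simp
    qed
  qed
qed

end
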